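(* Let $X$ be a Banach space over $\mathbb{K}$ and let $N\in\mathbb{N}$. Suppose that every element of $\widehat{\otimes}_{\pi,s,N}X$ attains its projective symmetric norm, i.e. $\mathrm{NA}_{\pi,s,N}(X)=\widehat{\otimes}_{\pi,s,N}X$. Then the set $\mathrm{NA}({}^N X)$ of all $N$-homogeneous polynomials on $X$ that attain their norms is norm dense in $\mathcal{P}({}^N X)$, that is, $\overline{\mathrm{NA}({}^N X)}=\mathcal{P}({}^N X)$.
   Context: $\mathbb{K}$ is $\mathbb{R}$ or $\mathbb{C}$; $B_X$ and $S_X$ are the closed unit ball and unit sphere of $X$. For $z\in X$, $z^N:=z\otimes\cdots\otimes z$ ($N$ times). The $N$-fold projective symmetric tensor product $\widehat{\otimes}_{\pi,s,N}X$ is the completion of the linear span of $\{z^N:z\in X\}$ under the norm $\|z\|_{\pi,s,N}=\inf\{\sum_{k=1}^n|\lambda_k|: z=\sum_{k=1}^n\lambda_k x_k^N,\ n\in\mathbb{N},\ x_k\in S_X,\ \lambda_k\in\mathbb{K}\}$. An element $z\in\widehat{\otimes}_{\pi,s,N}X$ attains its projective symmetric norm if there are bounded sequences $(\lambda_n)_{n=1}^\infty\subset\mathbb{K}$ and $(x_n)_{n=1}^\infty\subset B_X$ with $z=\sum_{n=1}^\infty\lambda_n x_n^N$ and $\|z\|_{\pi,s,N}=\sum_{n=1}^\infty|\lambda_n|$; the set of all such $z$ is denoted $\mathrm{NA}_{\pi,s,N}(X)$. $\mathcal{P}({}^N X)$ is the Banach space of continuous scalar-valued $N$-homogeneous polynomials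 on $X$ with norm $\|P\|=\sup_{x\in B_X}|P(x)|$; $P$ attains its norm if this supremum is a maximum, and $\mathrm{NA}({}^N X)$ is the set of such $P$. *)

theory Defs
  imports "HOL-Analysis.Analysis" "HOL-Library.Poly_Mapping"
begin

text \<open>
  The scalar field \<open>\<K>\<close> is \<open>\<real>\<close> or \<open>\<complex>\<close>: the class contains exactly the normed fields that are,
  as normed real algebras, isometrically isomorphic to one of the two.
\<close>

class real_or_complex = real_normed_field +
  assumes real_or_complex:
    "\<exists>f :: 'a \<Rightarrow> complex.
       (\<forall>x y. f (x + y) = f x + f y) \<and> (\<forall>x y. f (x * y) = f x * f y) \<and>
       (\<forall>r x. f (r *\<^sub>R x) = r *\<^sub>R f x) \<and> (\<forall>x. cmod (f x) = norm x) \<and>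
       (range f = \<real> \<or> range f = UNIV)"

instance real :: real_or_complex
proof
  show "\<exists>f :: real \<Rightarrow> complex.
       (\<forall>x y. f (x + y) = f x + f y) \<and> (\<forall>x y. f (x * y) = f x * f y) \<and>
       (\<forall>r x. f (r *\<^sub>R x) = r *\<^sub>R f x) \<and> (\<forall>x. cmod (f x) = norm x) \<and>
       (range f = \<real> \<or> range f = UNIV)"
    by (rule exI[of _ complex_of_real]) (auto simp: Reals_def scaleR_conv_of_real)
qed

instance complex :: real_or_complex
proof
  show "\<exists>f :: complex \<Rightarrow> complex.
       (\<forall>x y. f (x + y) = f x + f y) \<and> (\<forall>x y. f (x * y) = f x * f y) \<and>
       (\<forall>r x. f (r *\<^sub>R x) = r *\<^sub>R f x) \<and> (\<forall>x. cmod (f x) = norm x) \<and>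
       (range f = \<real> \<or> range f = UNIV)"
    by (rule exI[of _ id]) auto
qed

text \<open>
  A Banach space over \<open>\<K>\<close>: the type class \<^class>\<open>banach\<close> supplies the norm, its completeness and the
  underlying real structure; the \<open>\<K>\<close>-multiplication is an additional operation extending the real one.
\<close>

locale banach_space_over = vector_space scl
  for scl :: "'k::real_or_complex \<Rightarrow> 'x::banach \<Rightarrow> 'x" +
  assumes scl_of_real: "scl (of_real r) x = r *\<^sub>R x"
    and norm_scl: "norm (scl a x) = norm a * norm x"


section \<open>Homogeneous polynomials\<close>

text \<open>Elements of \<open>X\<^sup>N\<close> are lists of length \<open>N\<close>; values on lists of other lengths are irrelevant.\<close>

definition multilinear :: "('k::real_or_complex \<Rightarrow> 'x::banach \<Rightarrow> 'x) \<Rightarrow> nat \<Rightarrow> ('x list \<Rightarrow> 'k) \<Rightarrow> bool" where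
  "multilinear scl N A \<longleftrightarrow>
     (\<forall>xs i. length xs = N \<and> i < N \<longrightarrow> Vector_Spaces.linear scl (*) (\<lambda>x. A (xs[i := x])))"

definition hom_polys :: "('k::real_or_complex \<Rightarrow> 'x::banach \<Rightarrow> 'x) \<Rightarrow> nat \<Rightarrow> ('x \<Rightarrow> 'k) set" where
  "hom_polys scl N =
     {P. continuous_on UNIV P \<and> (\<exists>A. multilinear scl N A \<and> (\<forall>x. P x = A (replicate N x)))}"

definition poly_norm :: "('x::banach \<Rightarrow> 'k::real_or_complex) \<Rightarrow> real" where
  "poly_norm P = (SUP x\<in>cball 0 1. norm (P x))"

definition NA_polys :: "('k::real_or_complex \<Rightarrow> 'x::banach \<Rightarrow> 'x) \<Rightarrow> nat \<Rightarrow> ('x \<Rightarrow> 'k) set" where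
  "NA_polys scl N = {P \<in> hom_polys scl N. \<exists>x\<in>cball 0 1. norm (P x) = poly_norm P}"

definition poly_closure ::
  "('k::real_or_complex \<Rightarrow> 'x::banach \<Rightarrow> 'x) \<Rightarrow> nat \<Rightarrow> ('x \<Rightarrow> 'k) set \<Rightarrow> ('x \<Rightarrow> 'k) set" where
  "poly_closure scl N S =
     {P \<in> hom_polys scl N. \<forall>e>0. \<exists>Q\<in>S. poly_norm (\<lambda>x. P x - Q x) < e}"


section \<open>The symmetric tensor power with its projective norm\<close>

text \<open>
  The algebraic tensor power \<open>X \<otimes> \<dots> \<otimes> X\<close> is the free vector space on \<open>X\<^sup>N\<close> modulo the relations
  of multilinearity; its elements are represented as cosets.
\<close>

definition free_scale :: "'k::field \<Rightarrow> ('b \<Rightarrow>\<^sub>0 'k) \<Rightarrow> ('b \<Rightarrow>\<^sub>0 'k)" where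
  "free_scale c f = Poly_Mapping.map ((*) c) f"

lemma lookup_free_scale [simp]:
  "Poly_Mapping.lookup (free_scale c f) b = c * Poly_Mapping.lookup f b"
  by (simp add: free_scale_def Poly_Mapping.map.rep_eq when_def)

lemma vector_space_free_scale: "vector_space free_scale"
  by unfold_locales (auto intro!: poly_mapping_eqI simp: lookup_add algebra_simps)

abbreviation free_gen :: "'b \<Rightarrow> ('b \<Rightarrow>\<^sub>0 'k::field)" where
  "free_gen b \<equiv> Poly_Mapping.single b 1"

definition tensor_relations ::
  "('k::real_or_complex \<Rightarrow> 'x::banach \<Rightarrow> 'x) \<Rightarrow> nat \<Rightarrow> ('x list \<Rightarrow>\<^sub>0 'k) set" where
  "tensor_relations scl N =
     {free_gen (xs[i := x + y]) - free_gen (xs[i := x]) - free_gen (xs[i := y])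
        | xs i x y. length xs = N \<and> i < N} \<union>
     {free_gen (xs[i := scl c x]) - free_scale c (free_gen (xs[i := x]))
        | xs i c x. length xs = N \<and> i < N}"

definition tensor_class ::
  "('k::real_or_complex \<Rightarrow> 'x::banach \<Rightarrow> 'x) \<Rightarrow> nat \<Rightarrow> ('x list \<Rightarrow>\<^sub>0 'k) \<Rightarrow> ('x list \<Rightarrow>\<^sub>0 'k) set" where
  "tensor_class scl N f = {g. g - f \<in> module.span free_scale (tensor_relations scl N)}"

text \<open>The elementary symmetric tensor \<open>z \<otimes> \<dots> \<otimes> z\<close> is \<open>tensor_class scl N (free_pow N z)\<close>.\<close>

definition free_pow :: "nat \<Rightarrow> 'x \<Rightarrow> ('x list \<Rightarrow>\<^sub>0 'k::real_or_complex)" where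
  "free_pow N z = free_gen (replicate N z)"

definition free_sym :: "nat \<Rightarrow> ('x list \<Rightarrow>\<^sub>0 'k::real_or_complex) set" where
  "free_sym N = module.span free_scale (range (free_pow N))"

text \<open>
  The span of the elementary symmetric tensors in the quotient, as the image of the corresponding
  span in the free space.
\<close>

definition sym_tensors ::
  "('k::real_or_complex \<Rightarrow> 'x::banach \<Rightarrow> 'x) \<Rightarrow> nat \<Rightarrow> ('x list \<Rightarrow>\<^sub>0 'k) set set" where
  "sym_tensors scl N = tensor_class scl N ` free_sym N"

text \<open>The empty sum (\<open>n = 0\<close>) is admitted; this matters only for \<open>X = {0}\<close>, whose unit sphere is empty.\<close>

definition sym_proj_norm ::
  "('k::real_or_complex \<Rightarrow> 'x::banach \<Rightarrow> 'x) \<Rightarrow> nat \<Rightarrow> ('x list \<Rightarrow>\<^sub>0 'k) set \<Rightarrow> real" where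
  "sym_proj_norm scl N u =
     Inf {(\<Sum>k<n. norm (l k)) | (n :: nat) l x.
            (\<forall>k<n. x k \<in> sphere 0 1) \<and>
            u = tensor_class scl N (\<Sum>k<n. free_scale (l k) (free_pow N (x k)))}"

text \<open>
  The completion, which is determined up to isometric isomorphism: a Banach space \<open>E\<close> over \<open>\<K>\<close> together
  with a linear isometry \<open>\<iota>\<close> from the space of symmetric tensors onto a dense subspace of \<open>E\<close>. Linearity
  of \<open>\<iota>\<close> is expressed on representatives, which is how the quotient operations are defined.
\<close>

locale sym_proj_tensor_product =
  X: banach_space_over scaleX + E: banach_space_over scaleE
  for scaleX :: "'k::real_or_complex \<Rightarrow> 'x::banach \<Rightarrow> 'x"
    and scaleE :: "'k \<Rightarrow> 'e::banach \<Rightarrow> 'e" +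
  fixes N :: nat
    and \<iota> :: "('x list \<Rightarrow>\<^sub>0 'k) set \<Rightarrow> 'e"
  assumes embed_add: "\<lbrakk>f \<in> free_sym N; g \<in> free_sym N\<rbrakk> \<Longrightarrow>
      \<iota> (tensor_class scaleX N (f + g)) = \<iota> (tensor_class scaleX N f) + \<iota> (tensor_class scaleX N g)"
    and embed_scale: "f \<in> free_sym N \<Longrightarrow>
      \<iota> (tensor_class scaleX N (free_scale c f)) = scaleE c (\<iota> (tensor_class scaleX N f))"
    and embed_norm: "u \<in> sym_tensors scaleX N \<Longrightarrow> norm (\<iota> u) = sym_proj_norm scaleX N u"
    and embed_dense: "closure (\<iota> ` sym_tensors scaleX N) = UNIV"

text \<open>The norm of \<open>E\<close> is the extension of the projective symmetric norm to the completion.\<close>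

definition NA_tensors ::
  "('k::real_or_complex \<Rightarrow> 'x::banach \<Rightarrow> 'x) \<Rightarrow> ('k \<Rightarrow> 'e::banach \<Rightarrow> 'e) \<Rightarrow> nat \<Rightarrow>
     (('x list \<Rightarrow>\<^sub>0 'k) set \<Rightarrow> 'e) \<Rightarrow> 'e set" where
  "NA_tensors scaleX scaleE N \<iota> =
     {z. \<exists>(l :: nat \<Rightarrow> 'k) (x :: nat \<Rightarrow> 'x).
           bounded (range l) \<and> range x \<subseteq> cball 0 1 \<and>
           (\<lambda>n. scaleE (l n) (\<iota> (tensor_class scaleX N (free_pow N (x n))))) sums z \<and>
           (\<lambda>n. norm (l n)) sums norm z}"

end

theory Submission
  imports Defs
begin

text \<open>
  A polynomial \<open>P\<close> induces a bounded functional \<open>\<phi>\<close> on the symmetric tensor product with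
  \<open>\<phi> (x\<^sup>N) = P x\<close>. By the Bishop--Phelps theorem \<open>\<phi>\<close> is a norm limit of functionals \<open>\<psi>\<close> that
  attain their norm on the unit ball, say at \<open>z\<close>. Writing \<open>z = \<Sum> l n (x n)\<^sup>N\<close> with
  \<open>\<Sum> \<bar>l n\<bar>\<close> equal to the norm of \<open>z\<close>, the chain
  \<open>norm \<psi> = \<bar>\<Sum> l n \<psi> ((x n)\<^sup>N)\<bar> \<le> \<Sum> \<bar>l n\<bar> \<bar>\<psi> ((x n)\<^sup>N)\<bar> \<le> norm \<psi>\<close> forces the polynomial
  \<open>x \<mapsto> \<psi> (x\<^sup>N)\<close> to attain its norm at every \<open>x n\<close> with \<open>l n \<noteq> 0\<close>.
\<close>

section \<open>Sublinear functionals\<close>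

text \<open>The delicate passage is the one from a functional \<psi> back to a polynomial.
  Membership in \<open>hom_polys\<close> demands an N-linear form, and the form obtained by
  extending \<psi> algebraically to all tensors carries no norm control. Continuity is therefore
  derived from the bound on the diagonal alone: along each line the map is a polynomial of degree at
  most N in one real variable, and its coefficients are controlled by its values on [0, 1]. In
  Bishop-Phelps, Ekeland's principle supplies a point that almost supports the ball, and Hahn-Banach
  domination supplies the small functional that makes the support exact. This is carried out for
  real functionals; rotations of the ball then handle the general scalar field.\<close>

definition sublinear :: "('e::real_vector \<Rightarrow> real) \<Rightarrow> bool" where
  "sublinear p \<longleftrightarrow> (\<forall>x y. p (x + y) \<le> p x + p y) \<and> (\<forall>t\<ge>0. \<forall>x. p (t *\<^sub>R x) = t * p x)"

lemma sublinear_add: "sublinear p \<Longrightarrow> p (x + y) \<le> p x + p y"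
  by (simp add: sublinear_def)

lemma sublinear_scale: "sublinear p \<Longrightarrow> t \<ge> 0 \<Longrightarrow> p (t *\<^sub>R x) = t * p x"
  by (simp add: sublinear_def)

lemma sublinear_zero: "sublinear p \<Longrightarrow> p 0 = 0"
  using sublinear_scale[of p 0 0] by simp

lemma sublinear_minus: "sublinear p \<Longrightarrow> - p (- x) \<le> p x"
  using sublinear_add[of p x "- x"] sublinear_zero[of p] by simp

text \<open>The functionals constructed below are infima, for which one inequality is convenient to
  check; using it for 1/t at t x gives the reverse one.\<close>

lemma sublinearI:
  assumes add: "\<And>x y. p (x + y) \<le> p x + p y"
    and zero: "p 0 = 0"
    and scale: "\<And>t x. t > 0 \<Longrightarrow> p (t *\<^sub>R x) \<le> t * p x"
  shows "sublinear p"
proof -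
  have "p (t *\<^sub>R x) = t * p x" if "t \<ge> 0" for t x
  proof (cases "t = 0")
    case False
    with that have t: "t > 0" by simp
    have "p ((1/t) *\<^sub>R (t *\<^sub>R x)) \<le> (1/t) * p (t *\<^sub>R x)"
      by (rule scale) (use t in simp)
    hence "t * p x \<le> p (t *\<^sub>R x)" using t by (simp add: field_simps)
    with scale[OF t, of x] show ?thesis by simp
  qed (simp add: zero)
  with add show ?thesis by (simp add: sublinear_def)
qed

lemma sublinear_norm: "e \<ge> 0 \<Longrightarrow> sublinear (\<lambda>x::'e::real_normed_vector. e * norm x)"
  by (auto simp: sublinear_def distrib_left[symmetric] intro!: mult_left_mono norm_triangle_ineq)

text \<open>A sandwich lemma for the convex cone \<open>K\<close>. A linear g with g \<le> q and a
  \<le> g c on \<open>K\<close> satisfies g x = g (x + c) - g c \<le> q (x + c) - a, so the infimum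
  of the right-hand side is the natural \<open>p\<close>; conversely, every linear functional below
  \<open>p\<close> has both properties. It serves twice: with a ray in the proof of linearity, and
  with a cone of directions in Bishop-Phelps.\<close>

lemma sublinear_shift:
  fixes q :: "'e::real_vector \<Rightarrow> real" and K :: "('e \<times> real) set"
  assumes q: "sublinear q"
    and K0: "0 \<in> K"
    and Kadd: "\<And>u v. u \<in> K \<Longrightarrow> v \<in> K \<Longrightarrow> u + v \<in> K"
    and Kscale: "\<And>t u. t > 0 \<Longrightarrow> u \<in> K \<Longrightarrow> t *\<^sub>R u \<in> K"
    and le: "\<And>c a. (c, a) \<in> K \<Longrightarrow> a \<le> q c"
  obtains p where "sublinear p" "\<And>x. p x \<le> q x" "\<And>c a. (c, a) \<in> K \<Longrightarrow> p (- c) \<le> - a"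
proof
  define p where "p = (\<lambda>x. INF u\<in>K. q (x + fst u) - snd u)"
  \<comment> \<open>A minorant independent of the element of \<open>K\<close> keeps the infimum
    finite; it comes from a \<le> q c \<le> q (x + c) + q (- x).\<close>
  have low: "- q (- x) \<le> q (x + fst u) - snd u" if "u \<in> K" for x u
    using sublinear_add[OF q, of "x + fst u" "- x"] le[of "fst u" "snd u"] that by simp
  hence bdd: "bdd_below ((\<lambda>u. q (x + fst u) - snd u) ` K)" for x
    by (intro bdd_belowI2)
  have p_le: "p x \<le> q (x + c) - a" if "(c, a) \<in> K" for x c a
    using cINF_lower[OF bdd[of x] that] by (simp add: p_def)
  have p_ge: "m \<le> p x" if "\<And>c a. (c, a) \<in> K \<Longrightarrow> m \<le> q (x + c) - a" for x m
    unfolding p_def by (rule cINF_greatest) (use K0 that in auto)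
  show "p x \<le> q x" for x
    using p_le[of 0 0 x] K0 by (simp add: zero_prod_def)
  show "p (- c) \<le> - a" if "(c, a) \<in> K" for c a
    using p_le[OF that, of "- c"] sublinear_zero[OF q] by simp
  show "sublinear p"
  proof (rule sublinearI)
    fix x y
    have "p (x + y) - (q (y + d) - b) \<le> p x" if d: "(d, b) \<in> K" for d b
    proof (rule p_ge)
      fix c a assume c: "(c, a) \<in> K"
      have "(c + d, a + b) \<in> K" using Kadd[OF c d] by simp
      from p_le[OF this, of "x + y"] sublinear_add[OF q, of "x + c" "y + d"]
      show "p (x + y) - (q (y + d) - b) \<le> q (x + c) - a" by (simp add: algebra_simps)
    qed
    hence "p (x + y) - p x \<le> p y" by (intro p_ge) (simp add: algebra_simps)
    thus "p (x + y) \<le> p x + p y" by simp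
  next
    show "p 0 = 0"
    proof (rule antisym)
      show "p 0 \<le> 0" using p_le[of 0 0 0] K0 sublinear_zero[OF q] by (simp add: zero_prod_def)
      show "0 \<le> p 0" by (rule p_ge) (use le in force)
    qed
  next
    fix t :: real and x assume t: "t > 0"
    have "p (t *\<^sub>R x) / t \<le> p x"
    proof (rule p_ge)
      fix c a assume "(c, a) \<in> K"
      from Kscale[OF t this] have "(t *\<^sub>R c, t * a) \<in> K" by simp
      from p_le[OF this, of "t *\<^sub>R x"] sublinear_scale[OF q, of t "x + c"] t
      show "p (t *\<^sub>R x) / t \<le> q (x + c) - a" by (simp add: field_simps scaleR_add_right)
    qed
    thus "p (t *\<^sub>R x) \<le> t * p x" using t by (simp add: field_simps)
  qed
qed

text \<open>An infimum of sublinear functionals need not be subadditive. In a chain, the smaller of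
  two members bounds both terms at once, which restores subadditivity and gives Zorn's lemma its
  lower bounds.\<close>

lemma sublinear_INF_chain:
  assumes sub: "\<And>q. q \<in> C \<Longrightarrow> sublinear q" and ne: "C \<noteq> {}"
    and bdd: "\<And>x. bdd_below ((\<lambda>q. q x) ` C)"
    and chain: "\<And>q r. q \<in> C \<Longrightarrow> r \<in> C \<Longrightarrow> q \<le> r \<or> r \<le> q"
  shows "sublinear (\<lambda>x. INF q\<in>C. q x)"
proof (rule sublinearI)
  let ?p = "\<lambda>x. INF q\<in>C. q x"
  have p_le: "?p x \<le> q x" if "q \<in> C" for q x by (rule cINF_lower[OF bdd that])
  have p_ge: "m \<le> ?p x" if "\<And>q. q \<in> C \<Longrightarrow> m \<le> q x" for m x
    by (rule cINF_greatest[OF ne]) (rule that)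
  fix x y
  have "?p (x + y) - r y \<le> ?p x" if r: "r \<in> C" for r
  proof (rule p_ge)
    fix q assume q: "q \<in> C"
    obtain s where s: "s \<in> C" "s \<le> q" "s \<le> r" using chain[OF q r] q r by auto
    show "?p (x + y) - r y \<le> q x"
      using p_le[OF s(1), of "x + y"] sublinear_add[OF sub[OF s(1)], of x y]
        le_funD[OF s(2), of x] le_funD[OF s(3), of y] by linarith
  qed
  hence "?p (x + y) - ?p x \<le> ?p y" by (intro p_ge) (simp add: algebra_simps)
  thus "?p (x + y) \<le> ?p x + ?p y" by simp
  show "?p 0 = 0"
    using ne by (simp add: sublinear_zero[OF sub] cong: INF_cong_simp)
  fix t :: real assume t: "t > 0"
  have "?p (t *\<^sub>R x) / t \<le> ?p x"
    by (rule p_ge) (use p_le[of _ "t *\<^sub>R x"] sublinear_scale[OF sub, of _ t x] t in \<open>fastforce simp: field_simps\<close>)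
  thus "?p (t *\<^sub>R x) \<le> t * ?p x" using t by (simp add: field_simps)
qed

text \<open>A pointwise minimal sublinear functional \<open>q\<close> is odd: shifting along the ray through \<open>y\<close>
  gives a sublinear functional below \<open>q\<close> whose value at \<open>- y\<close> is at most \<open>- q y\<close>.\<close>

theorem sublinear_dominates_linear:
  fixes p :: "'e::real_vector \<Rightarrow> real"
  assumes p: "sublinear p"
  obtains g where "linear g" "\<And>x. g x \<le> p x"
proof -
  define A where "A = {q. sublinear q \<and> q \<le> p}"
  \<comment> \<open>Zorn's lemma is applied to the reversed order, so the maximal element it
    provides is a minimal functional.\<close>
  have "\<exists>m\<in>A. \<forall>q\<in>A. m \<ge> q \<longrightarrow> q = m"
  proof (rule predicate_Zorn)
    show "partial_order_on A (relation_of (\<ge>) A)"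
      by (rule partial_order_on_relation_ofI) auto
    fix C assume "C \<in> Chains (relation_of (\<ge>) A)"
    hence CA: "C \<subseteq> A" and chain: "\<And>q r. q \<in> C \<Longrightarrow> r \<in> C \<Longrightarrow> q \<le> r \<or> r \<le> q"
      by (auto simp: Chains_def relation_of_def)
    show "\<exists>u\<in>A. \<forall>q\<in>C. u \<le> q"
    proof (cases "C = {}")
      case True
      thus ?thesis using p by (auto simp: A_def)
    next
      case False
      \<comment> \<open>A bound uniform over the chain, from - q (- x) \<le> q x and q \<le>
        p.\<close>
      have "- p (- x) \<le> q x" if "q \<in> C" for q x
      proof -
        have "sublinear q" "q (- x) \<le> p (- x)" using that CA by (auto simp: A_def le_fun_def)
        thus ?thesis using sublinear_minus[of q x] by linarith
      qed
      hence bdd: "bdd_below ((\<lambda>q. q x) ` C)" for x by (intro bdd_belowI2)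
      have le: "(INF q\<in>C. q x) \<le> r x" if "r \<in> C" for r x by (rule cINF_lower[OF bdd that])
      have "sublinear (\<lambda>x. INF q\<in>C. q x)"
        by (rule sublinear_INF_chain[OF _ False bdd chain]) (use CA in \<open>auto simp: A_def\<close>)
      moreover have "(INF q\<in>C. q x) \<le> p x" for x
      proof -
        obtain r where r: "r \<in> C" using False by blast
        hence "r x \<le> p x" using CA by (auto simp: A_def le_fun_def)
        thus ?thesis using le[OF r, of x] by linarith
      qed
      ultimately show ?thesis using le by (intro bexI[of _ "\<lambda>x. INF q\<in>C. q x"]) (auto simp: A_def le_fun_def)
    qed
  qed
  then obtain q where q: "sublinear q" "q \<le> p" and min: "\<And>r. sublinear r \<Longrightarrow> r \<le> q \<Longrightarrow> r = q"
    unfolding A_def by (blast intro: order_trans)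
  have odd: "q (- y) = - q y" for y
  proof -
    define K where "K = {(t *\<^sub>R y, t * q y) | t. t \<ge> 0}"
    obtain r where r: "sublinear r" "\<And>x. r x \<le> q x" "\<And>c a. (c, a) \<in> K \<Longrightarrow> r (- c) \<le> - a"
    proof (rule sublinear_shift[OF q(1), of K])
      show "0 \<in> K" unfolding K_def zero_prod_def by (auto intro!: exI[of _ 0])
      show "u + v \<in> K" if uv: "u \<in> K" "v \<in> K" for u v
      proof -
        from uv obtain s t where "u = (s *\<^sub>R y, s * q y)" "v = (t *\<^sub>R y, t * q y)" "s \<ge> 0" "t \<ge> 0"
          by (auto simp: K_def)
        thus ?thesis unfolding K_def by (auto intro!: exI[of _ "s + t"] simp: algebra_simps)
      qed
      show "t *\<^sub>R u \<in> K" if "t > 0" "u \<in> K" for t u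
      proof -
        from that obtain s where "u = (s *\<^sub>R y, s * q y)" "s \<ge> 0" by (auto simp: K_def)
        thus ?thesis using \<open>t > 0\<close> unfolding K_def by (auto intro!: exI[of _ "t * s"])
      qed
      show "a \<le> q c" if "(c, a) \<in> K" for c a
        using that sublinear_scale[OF q(1)] by (auto simp: K_def)
    qed blast
    have "(1 *\<^sub>R y, 1 * q y) \<in> K" unfolding K_def by (auto intro!: exI[of _ 1])
    moreover have "r = q" by (rule min) (use r in \<open>auto simp: le_fun_def\<close>)
    ultimately have "q (- y) \<le> - q y" using r(3) by auto
    thus ?thesis using sublinear_minus[OF q(1), of y] by linarith
  qed
  have "linear q"
  proof (rule linearI)
    \<comment> \<open>Oddness turns q x \<le> q (x + y) + q (- y) into the missing
      inequality.\<close>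
    show "q (x + y) = q x + q y" for x y
      using sublinear_add[OF q(1), of x y] sublinear_add[OF q(1), of "x + y" "- y"] odd[of y] by simp
    show "q (t *\<^sub>R x) = t *\<^sub>R q x" for t x
      using sublinear_scale[OF q(1), of t x] sublinear_scale[OF q(1), of "- t" x] odd[of "t *\<^sub>R x"]
      by (cases "t \<ge> 0") auto
  qed
  thus ?thesis using that q(2) by (auto simp: le_fun_def)
qed

section \<open>The Bishop--Phelps theorem\<close>

text \<open>Ekeland's variational principle. \<open>T x\<close> collects the points reached from
  \<open>x\<close> by climbing with slope at least e, and the triangle inequality makes this
  relation transitive. A sequence that always climbs almost as high as possible is Cauchy, because
  distances are paid for by gains of a bounded function; its limit cannot be improved.\<close>

lemma ekeland_maximum:
  fixes f :: "'a::complete_space \<Rightarrow> real"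
  assumes S: "closed S" "S \<noteq> {}" and cont: "continuous_on S f"
    and bdd: "bdd_above (f ` S)" and e: "e > 0"
  obtains x where "x \<in> S" "\<And>y. y \<in> S \<Longrightarrow> f y \<le> f x + e * dist y x"
proof -
  define T where "T x = {y \<in> S. f x + e * dist y x \<le> f y}" for x
  have T_self: "x \<in> T x" if "x \<in> S" for x using that by (simp add: T_def)
  have T_sub: "T x \<subseteq> S" for x by (auto simp: T_def)
  have T_trans: "z \<in> T x" if "y \<in> T x" "z \<in> T y" for x y z
    using that mult_left_mono[OF dist_triangle[of z x y], of e] e by (auto simp: T_def algebra_simps)
  have bddT: "bdd_above (f ` T x)" for x
    by (rule bdd_above_mono[OF bdd]) (use T_sub in auto)
  obtain x0 where x0: "x0 \<in> S" using S by blast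
  have "\<exists>x. \<forall>n. x n \<in> S \<and> x (Suc n) \<in> T (x n) \<and> (\<forall>z\<in>T (x n). f z \<le> f (x (Suc n)) + (1/2)^n)"
  proof (rule dependent_nat_choice)
    show "\<exists>x. x \<in> S" using x0 by blast
    fix x n assume x: "x \<in> S"
    have "(SUP z\<in>T x. f z) - (1/2)^n < (SUP z\<in>T x. f z)" by simp
    then obtain y where y: "y \<in> T x" "(SUP z\<in>T x. f z) - (1/2)^n < f y"
      using less_cSUP_iff[OF _ bddT, of x] T_self[OF x] by blast
    have "f z \<le> f y + (1/2)^n" if "z \<in> T x" for z
      using cSUP_upper[OF that bddT] y(2) by linarith
    thus "\<exists>y. y \<in> S \<and> y \<in> T x \<and> (\<forall>z\<in>T x. f z \<le> f y + (1/2)^n)"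
      using y(1) T_sub by blast
  qed
  then obtain x where xS: "\<And>n. x n \<in> S" and xT: "\<And>n. x (Suc n) \<in> T (x n)"
    and sup: "\<And>n z. z \<in> T (x n) \<Longrightarrow> f z \<le> f (x (Suc n)) + (1/2)^n" by blast
  have xT': "x m \<in> T (x n)" if "n \<le> m" for m n
    using that by (induction rule: dec_induct) (use T_self xS xT T_trans in blast)+
  have "Bseq (\<lambda>n. f (x n))"
  proof -
    obtain M where "\<And>y. y \<in> S \<Longrightarrow> f y \<le> M" using bdd by (auto simp: bdd_above_def)
    moreover have "f (x 0) \<le> f (x n)" for n
    proof -
      have "f (x 0) + e * dist (x n) (x 0) \<le> f (x n)" using xT'[of 0 n] by (simp add: T_def)
      moreover have "0 \<le> e * dist (x n) (x 0)" using e by simp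
      ultimately show ?thesis by linarith
    qed
    ultimately show ?thesis
      by (intro BseqI'[of _ "\<bar>M\<bar> + \<bar>f (x 0)\<bar>"]) (smt (verit) real_norm_def xS)
  qed
  moreover have "incseq (\<lambda>n. f (x n))"
  proof (rule incseq_SucI)
    fix n
    have "0 \<le> e * dist (x (Suc n)) (x n)" using e by simp
    thus "f (x n) \<le> f (x (Suc n))" using xT[of n] by (simp add: T_def)
  qed
  ultimately have "convergent (\<lambda>n. f (x n))"
    by (simp add: Bseq_monoseq_convergent monoI1 incseq_def)
  hence fC: "Cauchy (\<lambda>n. f (x n))" by (rule convergent_Cauchy)
  have "Cauchy x"
  proof (rule metric_CauchyI)
    fix d :: real assume d: "d > 0"
    then obtain M where M: "\<And>m n. m \<ge> M \<Longrightarrow> n \<ge> M \<Longrightarrow> dist (f (x m)) (f (x n)) < e * d"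
      using metric_CauchyD[OF fC, of "e * d"] e by auto
    have less: "dist (x m) (x n) < d" if "M \<le> n" "n \<le> m" for m n
    proof -
      have "e * dist (x m) (x n) \<le> f (x m) - f (x n)" using xT'[OF that(2)] by (simp add: T_def)
      also have "\<dots> < e * d" using M[of m n] that by (simp add: dist_real_def)
      finally show ?thesis using e by simp
    qed
    have "dist (x m) (x n) < d" if "m \<ge> M" "n \<ge> M" for m n
      using less[of n m] less[of m n] that by (cases "n \<le> m") (auto simp: dist_commute)
    thus "\<exists>M. \<forall>m\<ge>M. \<forall>n\<ge>M. dist (x m) (x n) < d" by blast
  qed
  then obtain l where l: "x \<longlonglongrightarrow> l" by (auto simp: Cauchy_convergent_iff convergent_def)
  have lS: "l \<in> S" using closed_sequentially[OF S(1) _ l] xS by blast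
  have fl: "(\<lambda>n. f (x n)) \<longlonglongrightarrow> f l"
    by (rule continuous_on_tendsto_compose[OF cont l lS]) (simp add: xS)
  have lT: "l \<in> T (x n)" for n
  proof -
    have "f (x n) + e * dist l (x n) \<le> f l"
    proof (rule tendsto_le[OF _ fl])
      show "(\<lambda>m. f (x n) + e * dist (x m) (x n)) \<longlonglongrightarrow> f (x n) + e * dist l (x n)"
        by (intro tendsto_intros l)
      show "\<forall>\<^sub>F m in sequentially. f (x n) + e * dist (x m) (x n) \<le> f (x m)"
        using eventually_ge_at_top[of n] by eventually_elim (use xT' in \<open>auto simp: T_def\<close>)
    qed simp
    thus ?thesis using lS by (simp add: T_def)
  qed
  have "f y \<le> f l + e * dist y l" if y: "y \<in> S" for y
  proof (rule ccontr)
    assume gt: "\<not> f y \<le> f l + e * dist y l"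
    hence yT: "y \<in> T l" using y by (simp add: T_def)
    \<comment> \<open>By transitivity \<open>y\<close> lies in every \<open>T (x n)\<close>, so the
      near-optimal choice of the next point leaves it an advantage of at most (1/2)^n.\<close>
    have "f y \<le> f l"
    proof (rule LIMSEQ_le_const)
      show "(\<lambda>n. f (x (Suc n)) + (1/2)^n) \<longlonglongrightarrow> f l"
        using tendsto_add[OF LIMSEQ_Suc[OF fl] LIMSEQ_realpow_zero[of "1/2::real"]] by simp
      show "\<exists>N. \<forall>n\<ge>N. f y \<le> f (x (Suc n)) + (1/2)^n"
        using sup T_trans[OF lT yT] by blast
    qed
    moreover have "0 \<le> e * dist y l" using e by simp
    ultimately show False using gt by linarith
  qed
  thus ?thesis using that lS by blast
qed

text \<open>At an Ekeland point z, the gain of \<phi> in any direction into \<open>S\<close> is at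
  most e times the distance. A linear g with g \<le> e * norm and g (x - z) \<ge> \<phi> (x - z) on
  \<open>S\<close> then exists by the sandwich lemma, and subtracting it makes z a genuine
  maximum.\<close>

theorem bishop_phelps_real:
  fixes \<phi> :: "'e::banach \<Rightarrow> real"
  assumes \<phi>: "bounded_linear \<phi>" and S: "closed S" "convex S" "bounded S" "S \<noteq> {}" and e: "e > 0"
  obtains g z where "linear g" "\<And>x. \<bar>g x\<bar> \<le> e * norm x" "z \<in> S" "\<And>x. x \<in> S \<Longrightarrow> \<phi> x - g x \<le> \<phi> z - g z"
proof -
  interpret \<phi>: bounded_linear \<phi> by (rule \<phi>)
  have "bounded (\<phi> ` S)" by (rule bounded_linear_image[OF S(3) \<phi>])
  hence "bdd_above (\<phi> ` S)" by (rule bounded_imp_bdd_above)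
  then obtain z where z: "z \<in> S" "\<And>y. y \<in> S \<Longrightarrow> \<phi> y \<le> \<phi> z + e * dist y z"
    using ekeland_maximum[OF S(1,4) _ _ e, of \<phi>] linear_continuous_on[OF \<phi>] by blast
  \<comment> \<open>The graph of \<phi> over the cone generated by S - z. Convexity of
    \<open>S\<close> is what closes it under addition.\<close>
  define K where "K = {(t *\<^sub>R (b - z), \<phi> (t *\<^sub>R (b - z))) | t b. t \<ge> 0 \<and> b \<in> S}"
  obtain p where p: "sublinear p" "\<And>x. p x \<le> e * norm x" "\<And>c a. (c, a) \<in> K \<Longrightarrow> p (- c) \<le> - a"
  proof (rule sublinear_shift[of "\<lambda>x. e * norm x" K])
    show "sublinear (\<lambda>x::'e. e * norm x)" using e by (intro sublinear_norm) simp
    show "0 \<in> K"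
      unfolding K_def using z(1) by (auto simp: zero_prod_def \<phi>.zero intro!: exI[of _ 0] exI[of _ z])
    show "u + v \<in> K" if "u \<in> K" "v \<in> K" for u v
    proof -
      from that obtain s b t c where u: "u = (s *\<^sub>R (b - z), \<phi> (s *\<^sub>R (b - z)))" "s \<ge> 0" "b \<in> S"
        and v: "v = (t *\<^sub>R (c - z), \<phi> (t *\<^sub>R (c - z)))" "t \<ge> 0" "c \<in> S" by (auto simp: K_def)
      show ?thesis
      proof (cases "s + t = 0")
        case True
        hence "s = 0" "t = 0" using u v by auto
        thus ?thesis using u v \<open>0 \<in> K\<close> by (simp add: zero_prod_def \<phi>.zero)
      next
        case False
        hence st: "s + t > 0" using u v by simp
        \<comment> \<open>The convex combination with weights proportional to s and t, so that s (b
          - z) + t (c - z) is again one multiple of a direction into \<open>S\<close>.\<close>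
        let ?d = "(s / (s + t)) *\<^sub>R b + (t / (s + t)) *\<^sub>R c"
        have "?d \<in> S" by (rule convexD[OF S(2)]) (use u v st in \<open>auto simp: add_divide_distrib[symmetric]\<close>)
        moreover have "(s + t) *\<^sub>R (?d - z) = s *\<^sub>R (b - z) + t *\<^sub>R (c - z)"
          using st by (simp add: scaleR_add_right scaleR_diff_right scaleR_add_left)
        ultimately show ?thesis unfolding K_def using u v st
          by (auto simp: \<phi>.add[symmetric] intro!: exI[of _ "s + t"] exI[of _ ?d])
      qed
    qed
    show "t *\<^sub>R u \<in> K" if "t > 0" "u \<in> K" for t u
    proof -
      from that obtain s b where "u = (s *\<^sub>R (b - z), \<phi> (s *\<^sub>R (b - z)))" "s \<ge> 0" "b \<in> S"
        by (auto simp: K_def)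
      thus ?thesis unfolding K_def using \<open>t > 0\<close>
        by (auto intro!: exI[of _ "t * s"] exI[of _ b] simp: \<phi>.scaleR)
    qed
    show "a \<le> e * norm c" if "(c, a) \<in> K" for c a
    proof -
      from that obtain t b where "c = t *\<^sub>R (b - z)" "a = \<phi> (t *\<^sub>R (b - z))" and t: "t \<ge> 0" "b \<in> S"
        by (auto simp: K_def)
      moreover have "t * (\<phi> b - \<phi> z) \<le> t * (e * norm (b - z))"
        by (rule mult_left_mono) (use z(2)[OF t(2)] t in \<open>auto simp: dist_norm\<close>)
      ultimately show ?thesis by (simp add: \<phi>.scaleR \<phi>.diff mult_ac)
    qed
  qed blast
  obtain g where g: "linear g" "\<And>x. g x \<le> p x" using sublinear_dominates_linear[OF p(1)] by blast
  have neg: "g (- x) = - g x" for x by (rule linear_neg[OF g(1)])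
  show ?thesis
  proof
    show "\<bar>g x\<bar> \<le> e * norm x" for x
      using g(2)[of x] p(2)[of x] g(2)[of "- x"] p(2)[of "- x"] neg[of x] by simp
    show "\<phi> x - g x \<le> \<phi> z - g z" if x: "x \<in> S" for x
    proof -
      have "(1 *\<^sub>R (x - z), \<phi> (1 *\<^sub>R (x - z))) \<in> K"
        unfolding K_def using x by (auto intro!: exI[of _ 1] exI[of _ x])
      hence "p (- (x - z)) \<le> - \<phi> (x - z)" by (intro p(3)) simp
      hence "g (- (x - z)) \<le> - \<phi> (x - z)" using g(2)[of "- (x - z)"] by linarith
      thus ?thesis using neg[of "x - z"] linear_diff[OF g(1), of x z] by (simp add: \<phi>.diff)
    qed
  qed (use g z in auto)
qed

section \<open>From real functionals to functionals over the scalar field\<close>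

lemma real_or_complex_embedding:
  obtains f :: "'k::real_or_complex \<Rightarrow> complex"
  where "\<And>a b. f (a + b) = f a + f b" "\<And>a b. f (a * b) = f a * f b" "\<And>a. cmod (f a) = norm a"
    "\<And>r. f (of_real r) = of_real r" "range f = \<real> \<or> range f = UNIV"
proof -
  obtain f :: "'k \<Rightarrow> complex" where f: "\<And>x y. f (x + y) = f x + f y" "\<And>x y. f (x * y) = f x * f y"
    "\<And>r x. f (r *\<^sub>R x) = r *\<^sub>R f x" "\<And>x. cmod (f x) = norm x" "range f = \<real> \<or> range f = UNIV"
    using real_or_complex[where 'a='k] by (elim exE conjE) (rule that, simp_all)
  \<comment> \<open>The class does not list preservation of 1; it follows because f 1 is a nonzero
    idempotent.\<close>
  have "f 1 * f 1 = f 1" "f 1 \<noteq> 0" using f(2)[of 1 1] f(4)[of 1] by auto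
  hence "f 1 = 1" by simp
  hence "f (of_real r) = of_real r" for r
    using f(3)[of r 1] by (simp add: of_real_def)
  thus ?thesis using f by (intro that[of f]) simp_all
qed

text \<open>Completeness of the scalars is what lets a functional extend from a dense subspace to E
  and lets series of scalars be compared. It is transported along the isometry, whose range is
  closed.\<close>

instance real_or_complex \<subseteq> banach
proof
  fix X :: "nat \<Rightarrow> 'a"
  assume X: "Cauchy X"
  obtain f :: "'a \<Rightarrow> complex" where f: "\<And>a b. f (a + b) = f a + f b" "\<And>a b. f (a * b) = f a * f b"
    "\<And>a. cmod (f a) = norm a" "\<And>r. f (of_real r) = of_real r" "range f = \<real> \<or> range f = UNIV"
    by (rule real_or_complex_embedding) (rule that)
  have f_dist: "dist (f a) (f b) = dist a b" for a b
    using f(1)[of "a - b" b] f(3)[of "a - b"] by (simp add: dist_norm)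
  have "Cauchy (\<lambda>n. f (X n))" using X by (simp add: Cauchy_def f_dist)
  then obtain l where l: "(\<lambda>n. f (X n)) \<longlonglongrightarrow> l" by (auto simp: Cauchy_convergent_iff convergent_def)
  have "closed (range f)" using f(5) closed_complex_Reals by auto
  hence "l \<in> range f" using closed_sequentially[OF _ _ l] by blast
  then obtain y where "l = f y" by blast
  with l have "X \<longlonglongrightarrow> y" by (simp add: tendsto_iff f_dist)
  thus "convergent X" by (rule convergentI)
qed

text \<open>For \<open>\<K> = \<complex>\<close> the witness is \<open>z \<mapsto> g z - \<i> g (\<i> z)\<close>.\<close>

lemma (in banach_space_over) real_part_of_linear:
  fixes f :: "'k \<Rightarrow> complex" and g :: "'x \<Rightarrow> real"
  assumes f: "\<And>a b. f (a + b) = f a + f b" "\<And>a b. f (a * b) = f a * f b" "\<And>a. cmod (f a) = norm a"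
    "\<And>r. f (of_real r) = of_real r" "range f = \<real> \<or> range f = UNIV"
    and g: "linear g"
  obtains G where "Vector_Spaces.linear scl (*) G" "\<And>z. Re (f (G z)) = g z"
proof -
  have f_minus: "f (- a) = - f a" for a
    using f(1)[of a "- a"] f(4)[of 0] by (simp add: eq_neg_iff_add_eq_0 add.commute)
  have f_inj: "a = b" if "f a = f b" for a b
    using f(3)[of "a - b"] f(1)[of a "- b"] f_minus[of b] that by simp
  have g_add: "g (x + y) = g x + g y" and g_scale: "g (r *\<^sub>R x) = r * g x" for x y r
    using linear_add[OF g] linear_scale[OF g] by auto
  have g_neg: "g (- x) = - g x" for x by (rule linear_neg[OF g])
  have lin: "Vector_Spaces.linear scl (*) G"
    if "\<And>x y. G (x + y) = G x + G y" "\<And>a x. G (scl a x) = a * G x" for G :: "'x \<Rightarrow> 'k"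
    by unfold_locales (simp_all add: that algebra_simps)
  from f(5) show ?thesis
  proof
    assume R: "range f = \<real>"
    have a_real: "\<exists>r. a = of_real r" for a :: 'k
    proof -
      obtain r where "f a = of_real r" using R by (metis Reals_cases rangeI)
      hence "a = of_real r" by (intro f_inj) (simp add: f(4))
      thus ?thesis ..
    qed
    show ?thesis
    proof (rule that[of "\<lambda>z. of_real (g z)"])
      show "Vector_Spaces.linear scl (*) (\<lambda>z. of_real (g z) :: 'k)"
      proof (rule lin)
        fix a :: 'k and x
        obtain r where "a = of_real r" using a_real by blast
        thus "of_real (g (scl a x)) = a * of_real (g x)" by (simp add: scl_of_real g_scale)
      qed (simp add: g_add)
    qed (simp add: f(4))
  next
    assume U: "range f = UNIV"
    then obtain i where i: "f i = \<i>" by (metis surjD)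
    have ii: "i * i = - 1" by (rule f_inj) (use f(4)[of 1] in \<open>simp add: f(2) i f_minus\<close>)
    have a_eq: "\<exists>r s. a = of_real r + i * of_real s" for a :: 'k
    proof (intro exI)
      show "a = of_real (Re (f a)) + i * of_real (Im (f a))"
        by (rule f_inj) (simp add: f i complex_eq[symmetric])
    qed
    define G where "G z = (of_real (g z) - i * of_real (g (scl i z)) :: 'k)" for z
    have G_add: "G (x + y) = G x + G y" for x y
      by (simp add: G_def scale_right_distrib g_add algebra_simps)
    have G_real: "G (scl (of_real r) x) = of_real r * G x" for r x
    proof -
      have "scl i (r *\<^sub>R x) = r *\<^sub>R scl i x"
        by (simp add: scl_of_real[symmetric] mult.commute)
      thus ?thesis by (simp add: G_def scl_of_real g_scale algebra_simps)
    qed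
    have G_i: "G (scl i x) = i * G x" for x
    proof -
      have "scl i (scl i x) = - x" by (simp add: ii)
      hence "G (scl i x) = of_real (g (scl i x)) + i * of_real (g x)" by (simp add: G_def g_neg)
      also have "\<dots> = i * of_real (g x) - (i * i) * of_real (g (scl i x))" by (simp add: ii)
      also have "\<dots> = i * G x" by (simp only: G_def right_diff_distrib mult.assoc)
      finally show ?thesis .
    qed
    have "Vector_Spaces.linear scl (*) G"
    proof (rule lin[OF G_add])
      fix a :: 'k and x
      \<comment> \<open>The elements 1 and i span the field over the reals, so compatibility with
        real scalars and with i suffices.\<close>
      obtain r s where a: "a = of_real r + i * of_real s" using a_eq by blast
      have "G (scl a x) = G (scl (of_real r) x) + G (scl i (scl (of_real s) x))"
        by (simp only: a scale_left_distrib G_add scale_scale)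
      thus "G (scl a x) = a * G x" by (simp only: G_real G_i) (simp add: a algebra_simps)
    qed
    moreover have "Re (f (G z)) = g z" for z
    proof -
      have "f (G z) = f (of_real (g z)) + f (- (i * of_real (g (scl i z))))"
        unfolding G_def by (metis f(1) diff_conv_add_uminus)
      thus ?thesis by (simp add: f_minus f(2) f(4) i)
    qed
    ultimately show ?thesis using that by blast
  qed
qed

text \<open>Multiplying by a scalar of modulus 1 makes a value equal to its modulus. Estimates of
  real parts over a ball thereby become estimates of moduli.\<close>

lemma (in banach_space_over) exists_rotation:
  assumes "Vector_Spaces.linear scl (*) G"
  obtains z where "norm z = norm x" "G z = of_real (norm (G x))"
proof -
  interpret G: Vector_Spaces.linear scl "(*)" G by fact
  show ?thesis
  proof (cases "G x = 0")
    case True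
    thus ?thesis using that[of x] by simp
  next
    case False
    let ?a = "of_real (norm (G x)) / G x"
    have "norm ?a = 1" using False by (simp add: norm_divide)
    thus ?thesis using that[of "scl ?a x"] False by (simp add: norm_scl G.scale)
  qed
qed

text \<open>The real theorem is applied to the real part of \<phi>, and its perturbation is the real
  part of \<open>G\<close>. Since the unit ball is invariant under rotations, a maximum of the real
  part over it is also a maximum of the modulus.\<close>

theorem (in banach_space_over) bishop_phelps:
  assumes \<phi>: "Vector_Spaces.linear scl (*) \<phi>" and bound: "\<And>x. norm (\<phi> x) \<le> C * norm x" and e: "e > 0"
  obtains G z where "Vector_Spaces.linear scl (*) G" "\<And>x. norm (G x) \<le> e * norm x"
    "z \<in> cball 0 1" "\<And>x. x \<in> cball 0 1 \<Longrightarrow> norm (\<phi> x - G x) \<le> norm (\<phi> z - G z)"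
proof -
  interpret \<phi>: Vector_Spaces.linear scl "(*)" \<phi> by fact
  obtain f :: "'k \<Rightarrow> complex" where f: "\<And>a b. f (a + b) = f a + f b" "\<And>a b. f (a * b) = f a * f b"
    "\<And>a. cmod (f a) = norm a" "\<And>r. f (of_real r) = of_real r" "range f = \<real> \<or> range f = UNIV"
    by (rule real_or_complex_embedding) (rule that)
  have f_diff: "f (a - b) = f a - f b" for a b
    using f(1)[of "a - b" b] by simp
  have bl: "bounded_linear (\<lambda>x. Re (f (\<phi> x)))"
  proof (rule bounded_linear_intro)
    show "Re (f (\<phi> (x + y))) = Re (f (\<phi> x)) + Re (f (\<phi> y))" for x y by (simp add: \<phi>.add f(1))
    show "Re (f (\<phi> (r *\<^sub>R x))) = r *\<^sub>R Re (f (\<phi> x))" for r x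
      by (simp add: scl_of_real[symmetric] \<phi>.scale f)
    show "norm (Re (f (\<phi> x))) \<le> norm x * C" for x
      using abs_Re_le_cmod[of "f (\<phi> x)"] bound[of x] by (simp add: f(3) mult.commute)
  qed
  obtain g z where g: "linear g" "\<And>x. \<bar>g x\<bar> \<le> e * norm x" and z: "z \<in> cball 0 1"
    and max: "\<And>x. x \<in> cball 0 1 \<Longrightarrow> Re (f (\<phi> x)) - g x \<le> Re (f (\<phi> z)) - g z"
    using bishop_phelps_real[OF bl, of "cball 0 1" e] e by auto
  obtain G where G: "Vector_Spaces.linear scl (*) G" "\<And>z. Re (f (G z)) = g z"
    using real_part_of_linear[OF f g(1)] by blast
  interpret G: Vector_Spaces.linear scl "(*)" G by (rule G(1))
  have \<psi>: "Vector_Spaces.linear scl (*) (\<lambda>x. \<phi> x - G x)"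
    by unfold_locales (simp_all add: \<phi>.add G.add \<phi>.scale G.scale algebra_simps)
  show ?thesis
  proof
    show "norm (G x) \<le> e * norm x" for x
    proof -
      obtain y where y: "norm y = norm x" "G y = of_real (norm (G x))"
        using exists_rotation[OF G(1)] by blast
      thus ?thesis using G(2)[of y] g(2)[of y] by (simp add: f(4))
    qed
    show "norm (\<phi> x - G x) \<le> norm (\<phi> z - G z)" if x: "x \<in> cball 0 1" for x
    proof -
      obtain y where y: "norm y = norm x" "\<phi> y - G y = of_real (norm (\<phi> x - G x))"
        using exists_rotation[OF \<psi>] by blast
      have "norm (\<phi> x - G x) = Re (f (\<phi> y - G y))" by (simp add: y(2) f(4))
      also have "\<dots> \<le> Re (f (\<phi> z - G z))" using max[of y] x y(1) by (simp add: f_diff G(2))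
      also have "\<dots> \<le> norm (\<phi> z - G z)" using complex_Re_le_cmod[of "f (\<phi> z - G z)"] by (simp add: f(3))
      finally show ?thesis .
    qed
  qed (use G z in auto)
qed

section \<open>Homogeneous polynomials\<close>

text \<open>\<open>K\<close> is chosen before the coefficients and \<open>M\<close>, so one constant
  serves all lines through a point.\<close>

lemma coefficient_bound:
  "\<exists>K. \<forall>(c :: nat \<Rightarrow> 'k::real_normed_field) M.
     (\<forall>t. 0 \<le> t \<and> t \<le> 1 \<longrightarrow> norm (\<Sum>k\<le>n. c k * of_real t ^ k) \<le> M) \<longrightarrow> (\<forall>k\<le>n. norm (c k) \<le> K * M)"
proof (induction n)
  case 0
  show ?case by (rule exI[of _ 1]) auto
next
  case (Suc n)
  then obtain K where K: "\<And>(c :: nat \<Rightarrow> 'k) M k.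
     (\<And>t. 0 \<le> t \<Longrightarrow> t \<le> 1 \<Longrightarrow> norm (\<Sum>k\<le>n. c k * of_real t ^ k) \<le> M) \<Longrightarrow> k \<le> n \<Longrightarrow> norm (c k) \<le> K * M"
    by meson
  \<comment> \<open>On [0, 1] the combination formed below is at most (2^(n+1) + 1) M, which yields
    \<open>K'\<close> for the lower coefficients. The top one is the value at 1 minus the others,
    which yields \<open>L\<close>.\<close>
  define K' where "K' = \<bar>K\<bar> * (2 ^ Suc n + 1)"
  define L where "L = 1 + real (Suc n) * K'"
  have K'0: "0 \<le> K'" by (simp add: K'_def)
  show ?case
  proof (intro exI[of _ "L"] allI impI)
    fix c :: "nat \<Rightarrow> 'k" and M k
    assume *: "\<forall>t. 0 \<le> t \<and> t \<le> 1 \<longrightarrow> norm (\<Sum>k\<le>Suc n. c k * of_real t ^ k) \<le> M" and k: "k \<le> Suc n"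
    let ?p = "\<lambda>t::real. (\<Sum>k\<le>Suc n. c k * of_real t ^ k)"
    define d where "d k = c k * (2 ^ (Suc n - k) - 1)" for k
    have M: "norm (?p t) \<le> M" if "0 \<le> t" "t \<le> 1" for t using * that by blast
    have M0: "0 \<le> M" using M[of 0] norm_ge_zero[of "?p 0"] by linarith
    \<comment> \<open>\<open>2 ^ Suc n * p (t / 2) - p t\<close> has no term of degree \<open>Suc n\<close>.\<close>
    have d_eq: "(\<Sum>k\<le>n. d k * of_real t ^ k) = 2 ^ Suc n * ?p (t / 2) - ?p t" for t
    proof -
      have "2 ^ Suc n * ?p (t / 2) - ?p t =
          (\<Sum>k\<le>Suc n. 2 ^ Suc n * (c k * of_real (t/2) ^ k) - c k * of_real t ^ k)"
        by (simp only: sum_distrib_left sum_subtractf)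
      also have "\<dots> = (\<Sum>k\<le>Suc n. d k * of_real t ^ k)"
      proof (rule sum.cong[OF refl])
        fix k assume "k \<in> {..Suc n}"
        hence "(2::'k) ^ Suc n = 2 ^ (Suc n - k) * 2 ^ k" by (simp add: power_add[symmetric] del: power_Suc)
        thus "2 ^ Suc n * (c k * of_real (t/2) ^ k) - c k * of_real t ^ k = d k * of_real t ^ k"
          by (simp add: d_def power_divide algebra_simps)
      qed
      also have "\<dots> = (\<Sum>k\<le>n. d k * of_real t ^ k)" by (simp add: d_def)
      finally show ?thesis ..
    qed
    have low: "norm (c k) \<le> K' * M" if k: "k \<le> n" for k
    proof -
      have "norm (d k) \<le> K * ((2 ^ Suc n + 1) * M)"
      proof (rule K[OF _ k])
        fix t :: real assume t: "0 \<le> t" "t \<le> 1"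
        have "norm (2 ^ Suc n * ?p (t / 2) - ?p t) \<le> norm (2 ^ Suc n * ?p (t / 2)) + norm (?p t)"
          by (rule norm_triangle_ineq4)
        also have "\<dots> \<le> 2 ^ Suc n * M + M"
          unfolding norm_mult norm_power norm_numeral
          by (intro add_mono mult_left_mono M) (use t in auto)
        finally show "norm (\<Sum>k\<le>n. d k * of_real t ^ k) \<le> (2 ^ Suc n + 1) * M"
          unfolding d_eq by (simp add: algebra_simps)
      qed
      also have "\<dots> \<le> \<bar>K\<bar> * ((2 ^ Suc n + 1) * M)"
        by (rule mult_right_mono) (use M0 in auto)
      finally have "norm (d k) \<le> K' * M" by (simp add: K'_def)
      \<comment> \<open>The factor 2^(Suc n - k) - 1 is at least 1 because k \<le> n.\<close>
      moreover have "norm (c k) \<le> norm (d k)"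
      proof -
        have "(2::real) ^ 1 \<le> 2 ^ (Suc n - k)" by (rule power_increasing) (use k in auto)
        hence ge: "1 \<le> (2::real) ^ (Suc n - k) - 1" by simp
        have "norm ((2::'k) ^ (Suc n - k) - 1) = norm (of_real (2 ^ (Suc n - k) - 1) :: 'k)" by simp
        also have "\<dots> = 2 ^ (Suc n - k) - 1" unfolding norm_of_real using ge by linarith
        finally show ?thesis using mult_left_mono[OF ge norm_ge_zero[of "c k"]] by (simp add: d_def norm_mult)
      qed
      ultimately show ?thesis by linarith
    qed
    show "norm (c k) \<le> L * M"
    proof (cases "k \<le> n")
      case True
      have "K' * M \<le> L * M"
        by (rule mult_right_mono) (use K'0 M0 in \<open>auto simp: L_def algebra_simps\<close>)
      with low[OF True] show ?thesis by linarith
    next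
      case False
      hence k: "k = Suc n" using k by simp
      have "c k = ?p 1 - (\<Sum>k\<le>n. c k)" by (simp add: k)
      hence "norm (c k) \<le> norm (?p 1) + norm (\<Sum>k\<le>n. c k)" by (metis norm_triangle_ineq4)
      also have "\<dots> \<le> M + (\<Sum>k\<le>n. K' * M)"
        by (intro add_mono M order_trans[OF norm_sum] sum_mono low) auto
      also have "\<dots> = L * M" by (simp add: L_def algebra_simps)
      finally show ?thesis .
    qed
  qed
qed

context banach_space_over
begin

text \<open>Replaces list updates by a prefix, a free slot and a suffix. This is the shape needed
  for inductions that treat the arguments of \<open>replicate\<close> from left to right, with
  \<open>ys\<close> holding those already treated.\<close>

lemma multilinear_append_linear:
  assumes "multilinear scl N A" "length ys + Suc (length zs) = N"
  shows "Vector_Spaces.linear scl (*) (\<lambda>x. A (ys @ x # zs))"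
proof -
  have "Vector_Spaces.linear scl (*) (\<lambda>x. A ((ys @ 0 # zs)[length ys := x]))"
    using assms unfolding multilinear_def by (metis length_append length_Cons less_add_Suc1 add_Suc_right)
  thus ?thesis by simp
qed

lemma multilinear_replicate_scale:
  assumes A: "multilinear scl N A"
  shows "length ys + m = N \<Longrightarrow> A (ys @ replicate m (scl c x)) = c ^ m * A (ys @ replicate m x)"
proof (induction m arbitrary: ys)
  case (Suc m)
  interpret L: Vector_Spaces.linear scl "(*)" "\<lambda>z. A (ys @ z # replicate m x)"
    by (rule multilinear_append_linear[OF A]) (use Suc.prems in simp)
  show ?case using Suc.IH[of "ys @ [scl c x]"] Suc.prems L.scale[of c x] by simp
qed simp

text \<open>Expanding one slot x + t h leaves two forms with fewer free slots; the one with h in the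
  slot contributes its coefficients shifted by one degree. The coefficients need no explicit form,
  so symmetry of \<open>A\<close> never enters.\<close>

lemma multilinear_line_polynomial:
  assumes A: "multilinear scl N A"
  shows "length ys + m = N \<Longrightarrow>
    \<exists>c. \<forall>t. A (ys @ replicate m (x + t *\<^sub>R h)) = (\<Sum>k\<le>m. c k * of_real t ^ k)"
proof (induction m arbitrary: ys)
  case 0
  show ?case by (rule exI[of _ "\<lambda>_. A ys"]) simp
next
  case (Suc m)
  obtain a where a: "\<And>t. A ((ys @ [x]) @ replicate m (x + t *\<^sub>R h)) = (\<Sum>k\<le>m. a k * of_real t ^ k)"
    using Suc.IH[of "ys @ [x]"] Suc.prems by auto
  obtain b where b: "\<And>t. A ((ys @ [h]) @ replicate m (x + t *\<^sub>R h)) = (\<Sum>k\<le>m. b k * of_real t ^ k)"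
    using Suc.IH[of "ys @ [h]"] Suc.prems by auto
  define c where "c k = (if k \<le> m then a k else 0) + (case k of 0 \<Rightarrow> 0 | Suc j \<Rightarrow> b j)" for k
  have "A (ys @ replicate (Suc m) (x + t *\<^sub>R h)) = (\<Sum>k\<le>Suc m. c k * of_real t ^ k)" for t
  proof -
    let ?r = "replicate m (x + t *\<^sub>R h)"
    interpret L: Vector_Spaces.linear scl "(*)" "\<lambda>z. A (ys @ z # ?r)"
      by (rule multilinear_append_linear[OF A]) (use Suc.prems in simp)
    have "A (ys @ replicate (Suc m) (x + t *\<^sub>R h)) = A (ys @ x # ?r) + of_real t * A (ys @ h # ?r)"
      using L.add[of x "t *\<^sub>R h"] L.scale[of "of_real t" h] by (simp add: scl_of_real)
    also have "\<dots> = (\<Sum>k\<le>m. a k * of_real t ^ k) + (\<Sum>k\<le>m. b k * of_real t ^ Suc k)"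
      using a[of t] b[of t] by (simp add: sum_distrib_left mult_ac)
    also have "(\<Sum>k\<le>m. a k * of_real t ^ k) = (\<Sum>k\<le>Suc m. (if k \<le> m then a k else 0) * of_real t ^ k)"
      by simp
    also have "(\<Sum>k\<le>m. b k * of_real t ^ Suc k) = (\<Sum>k\<le>Suc m. (case k of 0 \<Rightarrow> 0 | Suc j \<Rightarrow> b j) * of_real t ^ k)"
      by (simp add: sum.atMost_Suc_shift del: sum.atMost_Suc)
    finally show ?thesis unfolding c_def by (simp only: sum.distrib[symmetric] distrib_right)
  qed
  thus ?case by blast
qed

lemma multilinear_bounded_continuous:
  assumes A: "multilinear scl N A" and bound: "\<And>x. norm (A (replicate N x)) \<le> C * norm x ^ N"
  shows "continuous_on UNIV (\<lambda>x. A (replicate N x))"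
proof -
  let ?Q = "\<lambda>x. A (replicate N x)"
  obtain K where K: "\<And>(c :: nat \<Rightarrow> 'k) M k.
     (\<And>t. 0 \<le> t \<Longrightarrow> t \<le> 1 \<Longrightarrow> norm (\<Sum>k\<le>N. c k * of_real t ^ k) \<le> M) \<Longrightarrow> k \<le> N \<Longrightarrow> norm (c k) \<le> K * M"
    using coefficient_bound[where 'k='k, of N] by meson
  have "isCont ?Q x" for x
  proof -
    \<comment> \<open>Bounds the polynomial on every unit segment starting at x; the absolute value
      covers a negative C.\<close>
    define M where "M = \<bar>C\<bar> * (norm x + 1) ^ N"
    have est: "norm (?Q (x + y) - ?Q x) \<le> real N * \<bar>K * M\<bar> * norm y" if y: "norm y \<le> 1" for y
    proof (cases "y = 0")
      case False
      define h where "h = (1 / norm y) *\<^sub>R y"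
      have h: "norm h = 1" "y = norm y *\<^sub>R h" using False by (auto simp: h_def)
      obtain c where c: "\<And>t. ?Q (x + t *\<^sub>R h) = (\<Sum>k\<le>N. c k * of_real t ^ k)"
        using multilinear_line_polynomial[OF A, of "[]" N x h] by auto
      have cb: "norm (c k) \<le> K * M" if "k \<le> N" for k
      proof (rule K[OF _ that])
        fix t :: real assume t: "0 \<le> t" "t \<le> 1"
        have "norm (x + t *\<^sub>R h) \<le> norm x + 1" using norm_triangle_ineq[of x "t *\<^sub>R h"] h t by simp
        hence "\<bar>C\<bar> * norm (x + t *\<^sub>R h) ^ N \<le> M"
          unfolding M_def by (intro mult_left_mono power_mono) auto
        moreover have "C * norm (x + t *\<^sub>R h) ^ N \<le> \<bar>C\<bar> * norm (x + t *\<^sub>R h) ^ N"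
          by (rule mult_right_mono) auto
        ultimately show "norm (\<Sum>k\<le>N. c k * of_real t ^ k) \<le> M"
          using bound[of "x + t *\<^sub>R h"] by (simp add: c[symmetric])
      qed
      have split: "(\<Sum>k\<le>N. u k) = u 0 + (\<Sum>k\<in>{1..N}. u k)" for u :: "nat \<Rightarrow> 'k"
      proof -
        have "{..N} = insert 0 {1..N}" by auto
        thus ?thesis by simp
      qed
      \<comment> \<open>The constant coefficient is the value at x and cancels, leaving only powers
        of norm y that are at most norm y.\<close>
      have "?Q (x + y) - ?Q x = (\<Sum>k\<in>{1..N}. c k * of_real (norm y) ^ k)"
        using c[of "norm y"] c[of 0] h(2) by (simp add: split power_0_left)
      also have "norm \<dots> \<le> (\<Sum>k\<in>{1..N}. norm (c k * of_real (norm y) ^ k))" by (rule norm_sum)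
      also have "\<dots> \<le> (\<Sum>k\<in>{1..N}. \<bar>K * M\<bar> * norm y)"
      proof (rule sum_mono)
        fix k assume k: "k \<in> {1..N}"
        have "norm y ^ k \<le> norm y ^ 1" by (rule power_decreasing) (use k y in auto)
        thus "norm (c k * of_real (norm y) ^ k) \<le> \<bar>K * M\<bar> * norm y"
          using cb[of k] k unfolding norm_mult norm_power by (intro mult_mono) auto
      qed
      finally show ?thesis by simp
    qed simp
    have "((\<lambda>y. ?Q (x + y) - ?Q x) \<longlongrightarrow> 0) (at 0)"
    proof (rule Lim_null_comparison)
      show "\<forall>\<^sub>F y in at 0. norm (?Q (x + y) - ?Q x) \<le> real N * \<bar>K * M\<bar> * norm y"
        unfolding eventually_at by (rule exI[of _ 1]) (use est in auto)
      show "((\<lambda>y. real N * \<bar>K * M\<bar> * norm y) \<longlongrightarrow> 0) (at (0::'x))"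
        by (auto intro!: tendsto_eq_intros)
    qed
    thus ?thesis unfolding isCont_iff by (simp add: LIM_zero_iff)
  qed
  thus ?thesis by (simp add: continuous_on_eq_continuous_at)
qed

lemma hom_poly_scale:
  assumes "P \<in> hom_polys scl N"
  shows "P (scl c x) = c ^ N * P x"
  using assms multilinear_replicate_scale[of N _ "[]" N c x] by (auto simp: hom_polys_def)

text \<open>Continuity at 0 bounds \<open>P\<close> on a small sphere and homogeneity spreads the
  bound. Positivity of \<open>C\<close> allows later division by it.\<close>

lemma hom_poly_bounded:
  assumes P: "P \<in> hom_polys scl N" and N: "N \<ge> 1"
  obtains C where "C > 0" "\<And>x. norm (P x) \<le> C * norm x ^ N"
proof -
  have P0: "P 0 = 0" using hom_poly_scale[OF P, of 0 0] N by (simp add: power_0_left)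
  have "isCont P 0" using P by (simp add: hom_polys_def continuous_on_eq_continuous_at)
  then obtain d where d: "d > 0" "\<And>x. dist x 0 < d \<Longrightarrow> dist (P x) (P 0) < 1"
    by (metis zero_less_one continuous_at_eps_delta)
  define r where "r = d / 2"
  have Pr: "norm (P x) \<le> 1" if "norm x = r" for x
    using d(1) d(2)[of x] that P0 by (simp add: r_def)
  have r: "r > 0" using d by (simp add: r_def)
  show ?thesis
  proof
    show "(1 / r) ^ N > 0" using r by simp
    fix x
    show "norm (P x) \<le> (1 / r) ^ N * norm x ^ N"
    proof (cases "x = 0")
      case True
      thus ?thesis using r by (simp add: P0)
    next
      case False
      let ?y = "(r / norm x) *\<^sub>R x"
      have "P ?y = of_real (r / norm x) ^ N * P x"
        using hom_poly_scale[OF P, of "of_real (r / norm x)" x] by (simp add: scl_of_real del: of_real_divide)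
      moreover have "norm (P ?y) \<le> 1" by (rule Pr) (use False r in simp)
      ultimately have "(r / norm x) ^ N * norm (P x) \<le> 1"
        using r by (simp add: norm_mult norm_power norm_divide)
      thus ?thesis using r False by (simp add: field_simps)
    qed
  qed
qed

end

section \<open>Symmetric tensors\<close>

interpretation free: vector_space "free_scale :: 'k::field \<Rightarrow> ('b \<Rightarrow>\<^sub>0 'k) \<Rightarrow> ('b \<Rightarrow>\<^sub>0 'k)"
  by (rule vector_space_free_scale)

definition free_lift :: "('b \<Rightarrow> 'k::field) \<Rightarrow> ('b \<Rightarrow>\<^sub>0 'k) \<Rightarrow> 'k" where
  "free_lift A f = (\<Sum>b\<in>Poly_Mapping.keys f. Poly_Mapping.lookup f b * A b)"

lemma free_lift_superset:
  assumes "finite S" "Poly_Mapping.keys f \<subseteq> S"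
  shows "free_lift A f = (\<Sum>b\<in>S. Poly_Mapping.lookup f b * A b)"
  unfolding free_lift_def
  by (rule sum.mono_neutral_left) (use assms in \<open>auto simp: in_keys_iff\<close>)

lemma linear_free_lift:
  fixes A :: "'b \<Rightarrow> 'k::field"
  shows "Vector_Spaces.linear free_scale (*) (free_lift A)"
proof unfold_locales
  fix f g :: "'b \<Rightarrow>\<^sub>0 'k" and c
  let ?S = "Poly_Mapping.keys f \<union> Poly_Mapping.keys g"
  have "free_lift A (f + g) = (\<Sum>b\<in>?S. Poly_Mapping.lookup (f + g) b * A b)"
    by (rule free_lift_superset) (auto simp: in_keys_iff lookup_add)
  also have "\<dots> = (\<Sum>b\<in>?S. Poly_Mapping.lookup f b * A b) + (\<Sum>b\<in>?S. Poly_Mapping.lookup g b * A b)"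
    by (simp add: lookup_add algebra_simps sum.distrib)
  also have "(\<Sum>b\<in>?S. Poly_Mapping.lookup f b * A b) = free_lift A f"
    by (rule free_lift_superset[symmetric]) auto
  also have "(\<Sum>b\<in>?S. Poly_Mapping.lookup g b * A b) = free_lift A g"
    by (rule free_lift_superset[symmetric]) auto
  finally show "free_lift A (f + g) = free_lift A f + free_lift A g" .
  have "free_lift A (free_scale c f)
      = (\<Sum>b\<in>Poly_Mapping.keys f. Poly_Mapping.lookup (free_scale c f) b * A b)"
    by (rule free_lift_superset) (auto simp: in_keys_iff)
  thus "free_lift A (free_scale c f) = c * free_lift A f"
    by (simp add: free_lift_def sum_distrib_left mult.assoc)
qed

lemma free_lift_gen [simp]: "free_lift A (free_gen b) = A b"
  by (simp add: free_lift_def)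

lemma tensor_class_eq_iff:
  "tensor_class scl N f = tensor_class scl N g \<longleftrightarrow> f - g \<in> free.span (tensor_relations scl N)"
proof
  assume "tensor_class scl N f = tensor_class scl N g"
  moreover have "f \<in> tensor_class scl N f" by (simp add: tensor_class_def free.span_zero)
  ultimately show "f - g \<in> free.span (tensor_relations scl N)" by (simp add: tensor_class_def)
next
  assume *: "f - g \<in> free.span (tensor_relations scl N)"
  have "h - f \<in> free.span (tensor_relations scl N) \<longleftrightarrow> h - g \<in> free.span (tensor_relations scl N)" for h
    using free.span_add[OF _ *, of "h - f"] free.span_diff[OF _ *, of "h - g"] by auto
  thus "tensor_class scl N f = tensor_class scl N g" by (simp add: tensor_class_def)
qed

lemma subspace_free_sym: "free.subspace (free_sym N)"
  unfolding free_sym_def by (rule free.subspace_span)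

lemma free_pow_in_free_sym: "free_pow N x \<in> free_sym N"
  unfolding free_sym_def by (rule free.span_base) simp

text \<open>Extending a functional linearly, without regard to norms, from the symmetric tensors to the
  whole tensor power produces a multilinear form for the associated polynomial without polarization.\<close>

lemma linear_extend_subspace:
  fixes h :: "('b \<Rightarrow>\<^sub>0 'k::field) \<Rightarrow> 'k"
  assumes S: "free.subspace S"
    and add: "\<And>f g. f \<in> S \<Longrightarrow> g \<in> S \<Longrightarrow> h (f + g) = h f + h g"
    and scale: "\<And>c f. f \<in> S \<Longrightarrow> h (free_scale c f) = c * h f"
  obtains L where "Vector_Spaces.linear free_scale (*) L" "\<And>f. f \<in> S \<Longrightarrow> L f = h f"
proof -
  interpret P: vector_space_pair "free_scale :: 'k \<Rightarrow> ('b \<Rightarrow>\<^sub>0 'k) \<Rightarrow> _" "(*) :: 'k \<Rightarrow> 'k \<Rightarrow> 'k"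
    by unfold_locales (simp_all add: algebra_simps)
  obtain B where B: "B \<subseteq> S" "free.independent B" "S \<subseteq> free.span B"
    using free.basis_exists[of S] by metis
  obtain L where L: "Vector_Spaces.linear free_scale (*) L" "\<And>b. b \<in> B \<Longrightarrow> L b = h b"
    using P.linear_independent_extend[OF B(2), of h] by blast
  interpret L: Vector_Spaces.linear free_scale "(*)" L by (rule L(1))
  \<comment> \<open>Membership in \<open>S\<close> is carried through the induction because
    \<open>h\<close> is linear only there.\<close>
  have "f \<in> S \<and> L f = h f" if "f \<in> free.span B" for f
    using that
  proof (induction rule: free.span_induct_alt)
    case base
    show ?case using free.subspace_0[OF S] scale[of 0 0] by (simp add: L.zero)
  next
    case (step c b f)
    have "b \<in> S" using step B(1) by blast
    moreover from this have "free_scale c b \<in> S" by (rule free.subspace_scale[OF S])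
    ultimately show ?case using step L(2)[of b]
      by (simp add: L.add L.scale add scale free.subspace_add[OF S])
  qed
  thus ?thesis using that L(1) B(3) by blast
qed

section \<open>Forms on the tensor quotient and representations over the unit sphere\<close>

context banach_space_over
begin

text \<open>Multilinearity is precisely vanishing on the generating relations, so
  \<open>free_lift A\<close> descends to tensor classes; \<open>multilinear_of_linear\<close> is the
  converse.\<close>

lemma free_lift_relations:
  assumes A: "multilinear scl N A" and f: "f \<in> free.span (tensor_relations scl N)"
  shows "free_lift A f = 0"
proof -
  interpret L: Vector_Spaces.linear free_scale "(*)" "free_lift A" by (rule linear_free_lift)
  have "free_lift A r = 0" if "r \<in> tensor_relations scl N" for r
  proof -
    from that consider
      xs i x y where "r = free_gen (xs[i := x + y]) - free_gen (xs[i := x]) - free_gen (xs[i := y])"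
        "length xs = N" "i < N"
    | xs i c x where "r = free_gen (xs[i := scl c x]) - free_scale c (free_gen (xs[i := x]))"
        "length xs = N" "i < N"
      unfolding tensor_relations_def by blast
    thus ?thesis
    proof cases
      case 1
      interpret M: Vector_Spaces.linear scl "(*)" "\<lambda>x. A (xs[i := x])"
        using A 1 by (simp add: multilinear_def)
      show ?thesis using M.add[of x y] by (simp add: 1 L.diff)
    next
      case 2
      interpret M: Vector_Spaces.linear scl "(*)" "\<lambda>x. A (xs[i := x])"
        using A 2 by (simp add: multilinear_def)
      show ?thesis using M.scale[of c x] by (simp add: 2 L.diff L.scale)
    qed
  qed
  with f show ?thesis
    by (induction rule: free.span_induct_alt) (simp_all add: L.zero L.add L.scale)
qed

lemma free_lift_cong_class:
  assumes "multilinear scl N A" "tensor_class scl N f = tensor_class scl N g"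
  shows "free_lift A f = free_lift A g"
proof -
  interpret L: Vector_Spaces.linear free_scale "(*)" "free_lift A" by (rule linear_free_lift)
  show ?thesis
    using free_lift_relations[OF assms(1), of "f - g"] assms(2) by (simp add: tensor_class_eq_iff L.diff)
qed

lemma multilinear_of_linear:
  assumes L: "Vector_Spaces.linear free_scale (*) L"
    and vanish: "\<And>r. r \<in> tensor_relations scl N \<Longrightarrow> L r = 0"
  shows "multilinear scl N (\<lambda>xs. L (free_gen xs))"
  unfolding multilinear_def
proof (intro allI impI)
  interpret L: Vector_Spaces.linear free_scale "(*)" L by (rule L)
  fix xs :: "'x list" and i assume i: "length xs = N \<and> i < N"
  show "Vector_Spaces.linear scl (*) (\<lambda>x. L (free_gen (xs[i := x])))"
  proof unfold_locales
    fix x y c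
    have "free_gen (xs[i := x + y]) - free_gen (xs[i := x]) - free_gen (xs[i := y])
        \<in> (tensor_relations scl N :: ('x list \<Rightarrow>\<^sub>0 'k) set)"
      unfolding tensor_relations_def using i by blast
    from vanish[OF this]
    show "L (free_gen (xs[i := x + y])) = L (free_gen (xs[i := x])) + L (free_gen (xs[i := y]))"
      by (simp add: L.diff diff_eq_eq add.commute)
    have "free_gen (xs[i := scl c x]) - free_scale c (free_gen (xs[i := x]))
        \<in> (tensor_relations scl N :: ('x list \<Rightarrow>\<^sub>0 'k) set)"
      unfolding tensor_relations_def using i by blast
    from vanish[OF this]
    show "L (free_gen (xs[i := scl c x])) = c * L (free_gen (xs[i := x]))"
      by (simp add: L.diff L.scale)
  qed
qed

text \<open>The scalar leaves the slots one at a time, each by one homogeneity relation;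
  \<open>ys\<close> collects the slots already passed.\<close>

lemma free_gen_replicate_scale:
  "length ys + m = N \<Longrightarrow>
    free_gen (ys @ replicate m (scl c x)) - free_scale (c ^ m) (free_gen (ys @ replicate m x))
      \<in> free.span (tensor_relations scl N)"
proof (induction m arbitrary: ys)
  case 0
  show ?case by (simp add: free.span_zero)
next
  case (Suc m)
  let ?z = "ys @ x # replicate m x" and ?w = "ys @ scl c x # replicate m x"
  have "free_gen (?z[length ys := scl c x]) - free_scale c (free_gen (?z[length ys := x]))
      \<in> (tensor_relations scl N :: ('x list \<Rightarrow>\<^sub>0 'k) set)"
    unfolding tensor_relations_def by (rule UnI2, rule CollectI, intro exI conjI, rule refl)
      (use Suc.prems in auto)
  hence 1: "free_scale (c ^ m) (free_gen ?w - free_scale c (free_gen ?z)) \<in> free.span (tensor_relations scl N)"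
    by (intro free.span_scale free.span_base) simp
  have 2: "free_gen (ys @ scl c x # replicate m (scl c x)) - free_scale (c ^ m) (free_gen ?w)
      \<in> free.span (tensor_relations scl N)"
    using Suc.IH[of "ys @ [scl c x]"] Suc.prems by simp
  show ?case
    using free.span_add[OF 2 1] by (simp add: free.scale_right_diff_distrib mult.commute)
qed

lemma tensor_class_pow_scale:
  "tensor_class scl N (free_pow N (scl c x)) = tensor_class scl N (free_scale (c ^ N) (free_pow N x))"
  unfolding tensor_class_eq_iff free_pow_def using free_gen_replicate_scale[of "[]" N N c x] by simp

lemma tensor_class_cong_add:
  assumes "tensor_class scl N f = tensor_class scl N f'" "tensor_class scl N g = tensor_class scl N g'"
  shows "tensor_class scl N (f + g) = tensor_class scl N (f' + g')"
  using assms free.span_add[of "f - f'" "tensor_relations scl N" "g - g'"]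
  by (simp add: tensor_class_eq_iff algebra_simps)

lemma tensor_class_cong_scale:
  assumes "tensor_class scl N f = tensor_class scl N f'"
  shows "tensor_class scl N (free_scale c f) = tensor_class scl N (free_scale c f')"
  using assms free.span_scale[of "f - f'" "tensor_relations scl N" c]
  by (simp add: tensor_class_eq_iff free.scale_right_diff_distrib)

text \<open>Makes the set in \<open>sym_proj_norm\<close> nonempty, so that its infimum is
  meaningful. A generator z^N is normalised by moving norm z ^ N into the coefficient; for z = 0 it
  is the zero tensor because N \<ge> 1.\<close>

lemma sym_tensor_representation:
  assumes N: "N \<ge> 1" and f: "f \<in> free_sym N"
  shows "\<exists>n l x. (\<forall>k<n. x k \<in> sphere 0 1) \<and>
    tensor_class scl N f = tensor_class scl N (\<Sum>k<(n::nat). free_scale (l k) (free_pow N (x k)))"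
  using f unfolding free_sym_def
proof (induction rule: free.span_induct_alt)
  case base
  show ?case by (rule exI[of _ 0]) simp
next
  case (step c b f)
  then obtain z where z: "b = free_pow N z" by blast
  from step obtain n :: nat and l x where nlx: "\<forall>k<n. x k \<in> sphere 0 1"
    "tensor_class scl N f = tensor_class scl N (\<Sum>k<n. free_scale (l k) (free_pow N (x k)))" by blast
  show ?case
  proof (cases "z = 0")
    case True
    have "tensor_class scl N b = tensor_class scl N 0"
      using tensor_class_pow_scale[of N 0 z] N by (simp add: z True power_0_left)
    hence "tensor_class scl N (free_scale c b + f) = tensor_class scl N f"
      using tensor_class_cong_add[OF tensor_class_cong_scale[of N b 0 c] refl[of "tensor_class scl N f"]] by simp
    thus ?thesis using nlx by auto
  next
    case False
    define y where "y = (1 / norm z) *\<^sub>R z"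
    have y: "y \<in> sphere 0 1" "scl (of_real (norm z)) y = z"
      using False by (simp_all add: y_def scl_of_real)
    define l' where "l' = l(n := c * of_real (norm z) ^ N)"
    define x' where "x' = x(n := y)"
    have "tensor_class scl N (free_scale c b) = tensor_class scl N (free_scale (l' n) (free_pow N (x' n)))"
      using tensor_class_cong_scale[OF tensor_class_pow_scale[of N "of_real (norm z)" y], of c] y
      by (simp add: z l'_def x'_def)
    hence "tensor_class scl N (free_scale c b + f) =
        tensor_class scl N (free_scale (l' n) (free_pow N (x' n)) + (\<Sum>k<n. free_scale (l k) (free_pow N (x k))))"
      by (rule tensor_class_cong_add[OF _ nlx(2)])
    also have "(\<Sum>k<n. free_scale (l k) (free_pow N (x k))) = (\<Sum>k<n. free_scale (l' k) (free_pow N (x' k)))"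
      by (rule sum.cong) (auto simp: l'_def x'_def)
    finally have "tensor_class scl N (free_scale c b + f) =
        tensor_class scl N (\<Sum>k<Suc n. free_scale (l' k) (free_pow N (x' k)))"
      by (simp add: add.commute)
    moreover have "\<forall>k<Suc n. x' k \<in> sphere 0 1" using nlx(1) y by (auto simp: x'_def less_Suc_eq)
    ultimately show ?thesis by blast
  qed
qed

text \<open>Every representation over the unit sphere bounds the value by C times its coefficient
  sum, and the infimum over representations is the projective norm. Values of \<open>A\<close> off
  the diagonal never appear.\<close>

lemma free_lift_bound:
  assumes A: "multilinear scl N A" and N: "N \<ge> 1" and C: "C > 0"
    and bound: "\<And>x. x \<in> sphere 0 1 \<Longrightarrow> norm (A (replicate N x)) \<le> C"
    and f: "f \<in> free_sym N"
  shows "norm (free_lift A f) \<le> C * sym_proj_norm scl N (tensor_class scl N f)"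
proof -
  interpret L: Vector_Spaces.linear free_scale "(*)" "free_lift A" by (rule linear_free_lift)
  have "norm (free_lift A f) / C \<le> sym_proj_norm scl N (tensor_class scl N f)"
    unfolding sym_proj_norm_def
  proof (rule cInf_greatest)
    show "{\<Sum>k<n. norm (l k) |(n::nat) l x. (\<forall>k<n. x k \<in> sphere 0 1) \<and>
        tensor_class scl N f = tensor_class scl N (\<Sum>k<n. free_scale (l k) (free_pow N (x k)))} \<noteq> {}"
      using sym_tensor_representation[OF N f] by blast
    fix s assume "s \<in> {\<Sum>k<n. norm (l k) |(n::nat) l x. (\<forall>k<n. x k \<in> sphere 0 1) \<and>
        tensor_class scl N f = tensor_class scl N (\<Sum>k<n. free_scale (l k) (free_pow N (x k)))}"
    then obtain n :: nat and l x where s: "s = (\<Sum>k<n. norm (l k))" and x: "\<And>k. k < n \<Longrightarrow> x k \<in> sphere 0 1"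
      and eq: "tensor_class scl N f = tensor_class scl N (\<Sum>k<n. free_scale (l k) (free_pow N (x k)))" by blast
    have "free_lift A f = (\<Sum>k<n. l k * A (replicate N (x k)))"
      using free_lift_cong_class[OF A eq] by (simp add: L.sum L.scale free_pow_def)
    also have "norm \<dots> \<le> (\<Sum>k<n. norm (l k) * C)"
      by (rule sum_norm_le) (auto simp: norm_mult intro!: mult_left_mono bound x)
    also have "\<dots> = s * C" by (simp add: s sum_distrib_right)
    finally show "norm (free_lift A f) / C \<le> s" using C by (simp add: field_simps)
  qed
  thus ?thesis using C by (simp add: field_simps)
qed

lemma sym_proj_norm_pow_le:
  assumes "x \<in> sphere 0 1"
  shows "sym_proj_norm scl N (tensor_class scl N (free_pow N x)) \<le> 1"
  unfolding sym_proj_norm_def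
proof (rule cInf_lower)
  show "1 \<in> {\<Sum>k<n. norm (l k) |(n::nat) l y. (\<forall>k<n. y k \<in> sphere 0 1) \<and>
      tensor_class scl N (free_pow N x) = tensor_class scl N (\<Sum>k<n. free_scale (l k) (free_pow N (y k)))}"
    by (rule CollectI, rule exI[of _ 1], rule exI[of _ "\<lambda>_. 1"], rule exI[of _ "\<lambda>_. x"]) (use assms in simp)
  show "bdd_below {\<Sum>k<n. norm (l k) |(n::nat) l y. (\<forall>k<n. y k \<in> sphere 0 1) \<and>
      tensor_class scl N (free_pow N x) = tensor_class scl N (\<Sum>k<n. free_scale (l k) (free_pow N (y k)))}"
    by (rule bdd_belowI[of _ 0]) (auto intro: sum_nonneg)
qed

end

section \<open>Duality between tensors and polynomials\<close>

text \<open>Each property is a closed condition by continuity and so passes from \<open>D\<close> to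
  its closure. Additivity is extended one variable at a time.\<close>

lemma linear_on_dense_closure:
  fixes scl :: "'k::real_or_complex \<Rightarrow> 'x::banach \<Rightarrow> 'x" and \<phi> :: "'x \<Rightarrow> 'k"
  assumes "banach_space_over scl" and dense: "closure D = UNIV" and cont: "continuous_on UNIV \<phi>"
    and add: "\<And>x y. x \<in> D \<Longrightarrow> y \<in> D \<Longrightarrow> \<phi> (x + y) = \<phi> x + \<phi> y"
    and scale: "\<And>c x. x \<in> D \<Longrightarrow> \<phi> (scl c x) = c * \<phi> x"
    and bound: "\<And>x. x \<in> D \<Longrightarrow> norm (\<phi> x) \<le> C * norm x"
  shows "Vector_Spaces.linear scl (*) \<phi>" and "norm (\<phi> x) \<le> C * norm x"
proof -
  interpret banach_space_over scl by fact
  have densityI: "P x" if "closed {x. P x}" "\<And>x. x \<in> D \<Longrightarrow> P x" for P x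
    using closure_minimal[OF _ that(1), of D] that(2) dense by auto
  have cont': "continuous_on UNIV (\<lambda>x. \<phi> (h x))" if "continuous_on UNIV h" for h :: "'x \<Rightarrow> 'x"
    using continuous_on_compose2[OF cont that] by simp
  have scl_cont: "continuous_on UNIV (scl c)" for c
  proof -
    have "bounded_linear (scl c)"
    proof (rule bounded_linear_intro)
      show "scl c (r *\<^sub>R x) = r *\<^sub>R scl c x" for r x
        by (simp add: scl_of_real[symmetric] mult.commute)
      show "norm (scl c x) \<le> norm x * norm c" for x by (simp add: norm_scl mult.commute)
    qed (rule scale_right_distrib)
    thus ?thesis by (rule linear_continuous_on)
  qed
  have "\<phi> (x + y) = \<phi> x + \<phi> y" for x y
  proof (rule densityI[of "\<lambda>x. \<phi> (x + y) = \<phi> x + \<phi> y" for y])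
    show "closed {x. \<phi> (x + y) = \<phi> x + \<phi> y}" for y
      by (intro closed_Collect_eq cont' continuous_intros cont)
    show "\<phi> (x + y) = \<phi> x + \<phi> y" if "x \<in> D" for x
      by (rule densityI[of "\<lambda>y. \<phi> (x + y) = \<phi> x + \<phi> y"])
        (intro closed_Collect_eq cont' continuous_intros cont, rule add[OF that])
  qed
  moreover have "\<phi> (scl c x) = c * \<phi> x" for c x
    by (rule densityI[of "\<lambda>x. \<phi> (scl c x) = c * \<phi> x"])
      (intro closed_Collect_eq cont' scl_cont continuous_intros cont, rule scale)
  ultimately show "Vector_Spaces.linear scl (*) \<phi>"
    by unfold_locales (simp_all add: algebra_simps)
  show "norm (\<phi> x) \<le> C * norm x"
    by (rule densityI[of "\<lambda>x. norm (\<phi> x) \<le> C * norm x"])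
      (intro closed_Collect_le continuous_intros cont, rule bound)
qed

context sym_proj_tensor_product
begin

abbreviation embed :: "('x list \<Rightarrow>\<^sub>0 'k) \<Rightarrow> 'e" where
  "embed f \<equiv> \<iota> (tensor_class scaleX N f)"

lemma embed_diff:
  assumes "f \<in> free_sym N" "g \<in> free_sym N"
  shows "embed (f - g) = embed f - embed g"
  using embed_add[OF free.subspace_diff[OF subspace_free_sym assms] assms(2)] by simp

lemma embed_pow_scale: "embed (free_pow N (scaleX c x)) = scaleE (c ^ N) (embed (free_pow N x))"
  by (simp add: X.tensor_class_pow_scale embed_scale free_pow_in_free_sym)

lemma norm_embed: "f \<in> free_sym N \<Longrightarrow> norm (embed f) = sym_proj_norm scaleX N (tensor_class scaleX N f)"
  by (rule embed_norm) (simp add: sym_tensors_def)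

lemma norm_embed_pow_le:
  assumes N: "N \<ge> 1"
  shows "norm (embed (free_pow N x)) \<le> norm x ^ N"
proof (cases "x = 0")
  case True
  have "embed (free_pow N x) = 0" using embed_pow_scale[of 0 x] N by (simp add: True power_0_left)
  thus ?thesis by simp
next
  case False
  define y where "y = (1 / norm x) *\<^sub>R x"
  have y: "y \<in> sphere 0 1" "scaleX (of_real (norm x)) y = x"
    using False by (simp_all add: y_def X.scl_of_real)
  have "norm (embed (free_pow N x)) = norm x ^ N * norm (embed (free_pow N y))"
    using embed_pow_scale[of "of_real (norm x)" y] by (simp add: y(2) E.norm_scl norm_power)
  also have "\<dots> \<le> norm x ^ N * 1"
    using X.sym_proj_norm_pow_le[OF y(1), of N]
    by (intro mult_left_mono) (simp_all add: norm_embed free_pow_in_free_sym)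
  finally show ?thesis by simp
qed

lemma embed_pow_cball:
  assumes N: "N \<ge> 1" and x: "x \<in> cball 0 1"
  shows "embed (free_pow N x) \<in> cball 0 1"
  using norm_embed_pow_le[OF N, of x] power_le_one[of "norm x" N] x by simp

lemma functional_of_hom_poly:
  assumes N: "N \<ge> 1" and P: "P \<in> hom_polys scaleX N"
  obtains \<phi> C where "Vector_Spaces.linear scaleE (*) \<phi>" "\<And>z. norm (\<phi> z) \<le> C * norm z"
    "\<And>x. \<phi> (embed (free_pow N x)) = P x"
proof -
  obtain A where A: "multilinear scaleX N A" "\<And>x. P x = A (replicate N x)"
    using P by (auto simp: hom_polys_def)
  obtain C where C: "C > 0" "\<And>x. norm (P x) \<le> C * norm x ^ N"
    using X.hom_poly_bounded[OF P N] by blast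
  interpret L: Vector_Spaces.linear free_scale "(*)" "free_lift A" by (rule linear_free_lift)
  have bound: "norm (free_lift A f) \<le> C * norm (embed f)" if "f \<in> free_sym N" for f
    unfolding norm_embed[OF that]
  proof (rule X.free_lift_bound[OF A(1) N C(1) _ that])
    show "norm (A (replicate N x)) \<le> C" if "x \<in> sphere 0 1" for x
      using C(2)[of x] that by (simp add: A(2))
  qed
  define D where "D = embed ` free_sym N"
  \<comment> \<open>A representative is chosen arbitrarily; the estimate \<open>lip\<close> shows
    that two representatives with the same image give the same value, and also lets \<phi>0 extend
    to the completion.\<close>
  define \<phi>0 where "\<phi>0 z = free_lift A (SOME f. f \<in> free_sym N \<and> embed f = z)" for z
  have lip: "norm (free_lift A f - free_lift A g) \<le> C * norm (embed f - embed g)"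
    if "f \<in> free_sym N" "g \<in> free_sym N" for f g
    using bound[OF free.subspace_diff[OF subspace_free_sym that]] by (simp add: L.diff embed_diff[OF that])
  have \<phi>0: "\<phi>0 (embed f) = free_lift A f" if f: "f \<in> free_sym N" for f
  proof -
    define g where "g = (SOME g. g \<in> free_sym N \<and> embed g = embed f)"
    have "g \<in> free_sym N \<and> embed g = embed f" unfolding g_def by (rule someI[of _ f]) (simp add: f)
    hence "norm (free_lift A g - free_lift A f) \<le> 0" using lip[of g f] f by simp
    thus ?thesis by (simp add: \<phi>0_def g_def)
  qed
  have "uniformly_continuous_on D \<phi>0"
  proof (rule lipschitz_on_uniformly_continuous[of C])
    show "C-lipschitz_on D \<phi>0"
      by (rule lipschitz_onI) (use C lip in \<open>auto simp: D_def dist_norm \<phi>0\<close>)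
  qed
  then obtain \<phi> where \<phi>: "uniformly_continuous_on (closure D) \<phi>" "\<And>z. z \<in> D \<Longrightarrow> \<phi>0 z = \<phi> z"
    by (rule uniformly_continuous_on_extension_on_closure) (rule that)
  have dense: "closure D = UNIV"
    using embed_dense by (simp add: D_def sym_tensors_def image_image)
  have \<phi>_embed: "\<phi> (embed f) = free_lift A f" if "f \<in> free_sym N" for f
    using \<phi>(2)[of "embed f"] \<phi>0[OF that] that by (simp add: D_def)
  have cont: "continuous_on UNIV \<phi>"
    using uniformly_continuous_imp_continuous[OF \<phi>(1)] by (simp add: dense)
  have add: "\<phi> (x + y) = \<phi> x + \<phi> y" if "x \<in> D" "y \<in> D" for x y
  proof -
    from that obtain f g where fg: "f \<in> free_sym N" "g \<in> free_sym N" "x = embed f" "y = embed g"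
      by (auto simp: D_def)
    thus ?thesis
      using \<phi>_embed free.subspace_add[OF subspace_free_sym fg(1,2)]
      by (simp add: embed_add[symmetric] L.add)
  qed
  have scale: "\<phi> (scaleE c x) = c * \<phi> x" if "x \<in> D" for c x
  proof -
    from that obtain f where f: "f \<in> free_sym N" "x = embed f" by (auto simp: D_def)
    thus ?thesis
      using \<phi>_embed free.subspace_scale[OF subspace_free_sym f(1)]
      by (simp add: embed_scale[symmetric] L.scale)
  qed
  have bnd: "norm (\<phi> x) \<le> C * norm x" if "x \<in> D" for x
    using that bound by (auto simp: D_def \<phi>_embed)
  show ?thesis
  proof (rule that)
    show "Vector_Spaces.linear scaleE (*) \<phi>"
      by (rule linear_on_dense_closure(1)[OF E.banach_space_over_axioms dense cont add scale bnd])
    show "norm (\<phi> z) \<le> C * norm z" for z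
      by (rule linear_on_dense_closure(2)[OF E.banach_space_over_axioms dense cont add scale bnd])
    show "\<phi> (embed (free_pow N x)) = P x" for x
      by (simp add: \<phi>_embed free_pow_in_free_sym A(2)) (simp add: free_pow_def)
  qed
qed

lemma hom_poly_of_functional:
  assumes N: "N \<ge> 1" and \<psi>: "Vector_Spaces.linear scaleE (*) \<psi>" and bound: "\<And>z. norm (\<psi> z) \<le> C * norm z"
  shows "(\<lambda>x. \<psi> (embed (free_pow N x))) \<in> hom_polys scaleX N"
proof -
  interpret \<psi>: Vector_Spaces.linear scaleE "(*)" \<psi> by (rule \<psi>)
  \<comment> \<open>All representatives of symmetric tensors, not only those in
    \<open>free_sym\<close>. Thus \<open>S\<close> contains the tensor relations, and a linear
    extension from \<open>S\<close> to the free space automatically vanishes on them.\<close>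
  define S where "S = {h. \<exists>f\<in>free_sym N. tensor_class scaleX N h = tensor_class scaleX N f}"
  have add: "h + h' \<in> S \<and> \<psi> (embed (h + h')) = \<psi> (embed h) + \<psi> (embed h')"
    if "h \<in> S" "h' \<in> S" for h h'
  proof -
    from that obtain f f' where f: "f \<in> free_sym N" "tensor_class scaleX N h = tensor_class scaleX N f"
      "f' \<in> free_sym N" "tensor_class scaleX N h' = tensor_class scaleX N f'" by (auto simp: S_def)
    have "tensor_class scaleX N (h + h') = tensor_class scaleX N (f + f')"
      by (rule X.tensor_class_cong_add) (use f in auto)
    moreover have "f + f' \<in> free_sym N" using free.subspace_add[OF subspace_free_sym] f by blast
    ultimately show ?thesis using f by (auto simp: S_def embed_add \<psi>.add)
  qed
  have scale: "free_scale c h \<in> S \<and> \<psi> (embed (free_scale c h)) = c * \<psi> (embed h)"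
    if "h \<in> S" for c h
  proof -
    from that obtain f where f: "f \<in> free_sym N" "tensor_class scaleX N h = tensor_class scaleX N f"
      by (auto simp: S_def)
    have "tensor_class scaleX N (free_scale c h) = tensor_class scaleX N (free_scale c f)"
      by (rule X.tensor_class_cong_scale) (use f in auto)
    moreover have "free_scale c f \<in> free_sym N" using free.subspace_scale[OF subspace_free_sym] f by blast
    ultimately show ?thesis using f by (auto simp: S_def embed_scale \<psi>.scale)
  qed
  have sym_S: "f \<in> S" if "f \<in> free_sym N" for f using that by (auto simp: S_def)
  have S0: "0 \<in> S" by (rule sym_S) (rule free.subspace_0[OF subspace_free_sym])
  have "free.subspace S" by (rule free.subspaceI) (use S0 add scale in auto)
  then obtain L where L: "Vector_Spaces.linear free_scale (*) L" "\<And>h. h \<in> S \<Longrightarrow> L h = \<psi> (embed h)"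
    using linear_extend_subspace[of S "\<lambda>h. \<psi> (embed h)"] add scale by blast
  have vanish: "L r = 0" if "r \<in> tensor_relations scaleX N" for r
  proof -
    have r: "tensor_class scaleX N r = tensor_class scaleX N 0"
      unfolding tensor_class_eq_iff using that by (simp add: free.span_base)
    hence "r \<in> S" using S0 by (auto simp: S_def)
    moreover have "\<psi> (embed 0) = 0" using scale[OF S0, of 0] by simp
    ultimately show ?thesis using L(2)[of r] r by simp
  qed
  have A: "multilinear scaleX N (\<lambda>xs. L (free_gen xs))"
    by (rule X.multilinear_of_linear[OF L(1) vanish])
  have eq: "L (free_gen (replicate N x)) = \<psi> (embed (free_pow N x))" for x
    using L(2)[OF sym_S[OF free_pow_in_free_sym]] by (simp add: free_pow_def)
  have "norm (L (free_gen (replicate N x))) \<le> \<bar>C\<bar> * norm x ^ N" for x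
  proof -
    have "norm (\<psi> (embed (free_pow N x))) \<le> \<bar>C\<bar> * norm (embed (free_pow N x))"
      using bound[of "embed (free_pow N x)"] mult_right_mono[OF abs_ge_self[of C] norm_ge_zero] by (rule order_trans)
    also have "\<dots> \<le> \<bar>C\<bar> * norm x ^ N" by (intro mult_left_mono norm_embed_pow_le[OF N]) simp
    finally show ?thesis by (simp add: eq)
  qed
  from X.multilinear_bounded_continuous[OF A this]
  have "continuous_on UNIV (\<lambda>x. \<psi> (embed (free_pow N x)))" by (simp add: eq)
  thus ?thesis using A unfolding hom_polys_def by (auto simp: eq intro!: exI[of _ "\<lambda>xs. L (free_gen xs)"])
qed

lemma norm_attained_at_pow:
  assumes N: "N \<ge> 1" and \<psi>: "Vector_Spaces.linear scaleE (*) \<psi>" and bound: "\<And>z. norm (\<psi> z) \<le> C * norm z"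
    and z: "z \<in> cball 0 1" and max: "\<And>y. y \<in> cball 0 1 \<Longrightarrow> norm (\<psi> y) \<le> norm (\<psi> z)"
    and NA: "z \<in> NA_tensors scaleX scaleE N \<iota>"
  obtains x where "x \<in> cball 0 1" "norm (\<psi> (embed (free_pow N x))) = norm (\<psi> z)"
proof -
  interpret \<psi>: Vector_Spaces.linear scaleE "(*)" \<psi> by (rule \<psi>)
  let ?Q = "\<lambda>x. \<psi> (embed (free_pow N x))"
  from NA obtain l x where x: "\<And>n. x n \<in> cball 0 1"
    and sums: "(\<lambda>n. scaleE (l n) (embed (free_pow N (x n)))) sums z"
    and norm_sums: "(\<lambda>n. norm (l n)) sums norm z"
    unfolding NA_tensors_def by blast
  have "bounded_linear \<psi>"
  proof (rule bounded_linear_intro)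
    show "\<psi> (r *\<^sub>R y) = r *\<^sub>R \<psi> y" for r y
      using \<psi>.scale[of "of_real r" y] by (simp add: E.scl_of_real scaleR_conv_of_real)
    show "norm (\<psi> y) \<le> norm y * C" for y using bound[of y] by (simp add: mult.commute)
  qed (rule \<psi>.add)
  from bounded_linear.sums[OF this sums] have \<psi>_sums: "(\<lambda>n. l n * ?Q (x n)) sums \<psi> z"
    by (simp add: \<psi>.scale)
  have Q_le: "norm (?Q y) \<le> norm (\<psi> z)" if "y \<in> cball 0 1" for y
    by (rule max) (rule embed_pow_cball[OF N that])
  show ?thesis
  \<comment> \<open>If \<psi> z = 0, all \<open>l n\<close> may vanish, but then the maximum is 0
    and any point of the ball attains it.\<close>
  proof (cases "\<psi> z = 0")
    case True
    thus ?thesis using that[of 0] Q_le[of 0] by simp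
  next
    case False
    \<comment> \<open>The deficit of the n-th term in the chain of inequalities. Deficits are
      nonnegative and their sum is at most 0, because norm z \<le> 1 and the series for \<psi> z
      obeys the triangle inequality; hence all of them vanish.\<close>
    define d where "d n = norm (l n) * (norm (\<psi> z) - norm (?Q (x n)))" for n
    have d_nonneg: "0 \<le> d n" for n using Q_le[OF x[of n]] by (simp add: d_def)
    have nb: "norm (l n * ?Q (x n)) \<le> norm (l n) * norm (\<psi> z)" for n
      unfolding norm_mult by (intro mult_left_mono Q_le x) simp
    have sm: "summable (\<lambda>n. norm (l n) * norm (\<psi> z))"
      using norm_sums by (intro summable_mult2) (rule sums_summable)
    have sn: "summable (\<lambda>n. norm (l n * ?Q (x n)))"
      by (rule summable_comparison_test'[OF sm, of 0]) (use nb in simp)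
    have "d sums (norm z * norm (\<psi> z) - (suminf (\<lambda>n. norm (l n * ?Q (x n)))))"
      using sums_diff[OF sums_mult2[OF norm_sums, of "norm (\<psi> z)"] summable_sums[OF sn]]
      by (simp add: d_def[abs_def] norm_mult right_diff_distrib)
    moreover have "norm z * norm (\<psi> z) \<le> (suminf (\<lambda>n. norm (l n * ?Q (x n))))"
    proof -
      have "norm z * norm (\<psi> z) \<le> norm (\<psi> z)" using z by (simp add: mult_left_le_one_le)
      also have "\<dots> \<le> (suminf (\<lambda>n. norm (l n * ?Q (x n))))"
        using summable_norm[of "\<lambda>n. l n * ?Q (x n)", OF sn] sums_unique[OF \<psi>_sums] by simp
      finally show ?thesis .
    qed
    ultimately have "suminf d \<le> 0" "summable d" by (auto simp: sums_iff)
    moreover have "0 \<le> suminf d" using \<open>summable d\<close> d_nonneg by (intro suminf_nonneg) auto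
    ultimately have "d n = 0" for n using suminf_eq_zero_iff[of d] d_nonneg by auto
    moreover obtain n where "l n \<noteq> 0"
    proof -
      have "\<not> (\<forall>n. l n = 0)"
      proof
        assume "\<forall>n. l n = 0"
        hence "\<psi> z = 0" using \<psi>_sums by (simp add: sums_iff)
        with False show False ..
      qed
      thus ?thesis using that by blast
    qed
    ultimately have "norm (?Q (x n)) = norm (\<psi> z)" by (simp add: d_def) (metis)
    thus ?thesis using that x by blast
  qed
qed

end

section \<open>Density of the norm-attaining polynomials\<close>

theorem theorem3p1:
  fixes scaleX :: "'k::real_or_complex \<Rightarrow> 'x::banach \<Rightarrow> 'x"
    and scaleE :: "'k \<Rightarrow> 'e::banach \<Rightarrow> 'e"
    and \<iota> :: "('x list \<Rightarrow>\<^sub>0 'k) set \<Rightarrow> 'e"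
    and N :: nat
  assumes "N \<ge> 1"
    and "banach_space_over scaleX"
    and "sym_proj_tensor_product scaleX scaleE N \<iota>"
    and "NA_tensors scaleX scaleE N \<iota> = UNIV"
  shows "poly_closure scaleX N (NA_polys scaleX N) = hom_polys scaleX N"
proof -
  interpret sym_proj_tensor_product scaleX scaleE N \<iota> by fact
  have "P \<in> poly_closure scaleX N (NA_polys scaleX N)" if P: "P \<in> hom_polys scaleX N" for P
  proof -
    obtain \<phi> C where \<phi>: "Vector_Spaces.linear scaleE (*) \<phi>" "\<And>z. norm (\<phi> z) \<le> C * norm z"
      "\<And>x. \<phi> (embed (free_pow N x)) = P x"
      using functional_of_hom_poly[OF \<open>N \<ge> 1\<close> P] by blast
    interpret \<phi>: Vector_Spaces.linear scaleE "(*)" \<phi> by (rule \<phi>(1))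
    have "\<exists>Q\<in>NA_polys scaleX N. poly_norm (\<lambda>x. P x - Q x) < e" if e: "e > 0" for e
    proof -
      \<comment> \<open>Half of e leaves room for the strict inequality in
        \<open>poly_closure\<close>.\<close>
      obtain G z where G: "Vector_Spaces.linear scaleE (*) G" "\<And>y. norm (G y) \<le> (e / 2) * norm y"
        and z: "z \<in> cball 0 1" and max: "\<And>y. y \<in> cball 0 1 \<Longrightarrow> norm (\<phi> y - G y) \<le> norm (\<phi> z - G z)"
        by (rule E.bishop_phelps[OF \<phi>(1,2), of "e / 2"]) (use e in simp, rule that)
      interpret G: Vector_Spaces.linear scaleE "(*)" G by (rule G(1))
      define \<psi> where "\<psi> y = \<phi> y - G y" for y
      have \<psi>: "Vector_Spaces.linear scaleE (*) \<psi>"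
        by unfold_locales (simp_all add: \<psi>_def \<phi>.add G.add \<phi>.scale G.scale algebra_simps)
      have \<psi>_bound: "norm (\<psi> y) \<le> (C + e / 2) * norm y" for y
        using norm_triangle_ineq4[of "\<phi> y" "G y"] \<phi>(2)[of y] G(2)[of y]
        by (simp add: \<psi>_def distrib_right)
      have \<psi>_max: "norm (\<psi> y) \<le> norm (\<psi> z)" if "y \<in> cball 0 1" for y
        using max[OF that] by (simp add: \<psi>_def)
      define Q where "Q x = \<psi> (embed (free_pow N x))" for x
      have Q: "Q \<in> hom_polys scaleX N"
        unfolding Q_def by (rule hom_poly_of_functional[OF \<open>N \<ge> 1\<close> \<psi> \<psi>_bound])
      obtain x where x: "x \<in> cball 0 1" "norm (Q x) = norm (\<psi> z)"
        using norm_attained_at_pow[OF \<open>N \<ge> 1\<close> \<psi> \<psi>_bound z \<psi>_max] assms(4) by (auto simp: Q_def)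
      \<comment> \<open>The value at x equals the maximum of the modulus of \<psi> over the ball of
        E, which dominates Q on the ball of X.\<close>
      have "poly_norm Q = norm (Q x)"
        unfolding poly_norm_def
        by (rule cSup_eq_maximum) (use x \<psi>_max embed_pow_cball[OF \<open>N \<ge> 1\<close>] in \<open>auto simp: Q_def image_iff intro!: bexI[of _ x]\<close>)
      hence "Q \<in> NA_polys scaleX N" using Q x(1) by (auto simp: NA_polys_def)
      \<comment> \<open>The difference P - Q is G evaluated at x^N, and x^N stays in the unit ball
        of E.\<close>
      moreover have "poly_norm (\<lambda>x. P x - Q x) \<le> e / 2"
        unfolding poly_norm_def
      proof (rule cSUP_least)
        fix x :: 'x assume "x \<in> cball 0 1"
        hence "norm (embed (free_pow N x)) \<le> 1" using embed_pow_cball[OF \<open>N \<ge> 1\<close>] by simp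
        hence "(e / 2) * norm (embed (free_pow N x)) \<le> (e / 2) * 1" using e by (intro mult_left_mono) auto
        thus "norm (P x - Q x) \<le> e / 2"
          using G(2)[of "embed (free_pow N x)"] by (simp add: Q_def \<psi>_def \<phi>(3))
      qed simp
      ultimately show ?thesis using e by (intro bexI[of _ Q]) auto
    qed
    with P show ?thesis by (simp add: poly_closure_def)
  qed
  thus ?thesis by (auto simp: poly_closure_def)
qed

end
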